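(* Let $w,w'$ be positive braid words, and let $v,v'$ be the positive braid words such that $w^{-1}w'$ right-reverses to $v'v^{-1}$ with respect to Artin's presentation. Assume that there exists a sparse family of names $F$ such that each face of the reversing diagram for $w^{-1}w'$ contains exactly one crossing of $F$-separatrices, and any two $F$-separatrices cross at most once in that diagram. Then reversing is optimal for $(w,w')$, i.e. the combinatorial distance $\mathrm{dist}(wv',w'v)$ is equal to the number of faces of the reversing diagram for $w^{-1}w'$.
   Context: Fix $n\ge2$. The braid monoid $B_n^+$ is presented by generators $\sigma_1,\dots,\sigma_{n-1}$ and relations $\sigma_i\sigma_j=\sigma_j\sigma_i$ for $|i-j|\ge2$ and $\sigma_i\sigma_j\sigma_i=\sigma_j\sigma_i\sigma_j$ for $|i-j|=1$ (Artin's presentation). A positive ($n$-strand) braid word is a word in the letters $\sigma_1,\dots,\sigma_{n-1}$. For equivalent positive braid words $x,y$, the combinatorial distance $\mathrm{dist}(x,y)$ is the minimal number of applications of the relations $\sigma_i\sigma_j=\sigma_j\sigma_i$ ($|i-j|\ge2$) and $\sigma_i\sigma_j\sigma_i=\sigma_j\sigma_i\sigma_j$ ($|i-j|=1$) needed to transform $x$ into $y$. Right-reversing: one step replaces, in a word in the letters $\sigma_i^{\pm1}$, a subword $\sigma_i^{-1}\sigma_j$ by $\sigma_j\sigma_i^{-1}$ if $|i-j|\ge2$, by $\sigma_j\sigma_i\sigma_j^{-1}\sigma_i^{-1}$ if $|i-j|=1$, and by the empty word if $i=j$; steps with $i\ne j$ are called nontrivial. For all positive braid words $w,w'$, right-reversing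 $w^{-1}w'$ leads to a unique word of the form $v'v^{-1}$ with $v,v'$ positive, and then $wv'$ and $w'v$ are equivalent. The reversing diagram for $w^{-1}w'$ is the associated van Kampen diagram for the pair $(wv',w'v)$: it is a planar oriented graph with edges labeled by letters $\sigma_i$, starting with two paths labeled $w$ and $w'$ from a common source, in which each nontrivial reversing step of $\sigma_i^{-1}\sigma_j$ adds one face closing the two diverging edges labeled $\sigma_i$, $\sigma_j$ (a square for $|i-j|\ge2$, a hexagon for $|i-j|=1$), and each trivial step identifies two edges with the same label. Its boundary paths from source to sink are labeled $wv'$ and $w'v$, and the number of its faces is the number of nontrivial steps in the reversing of $w^{-1}w'$ to $v'v^{-1}$ (independent of the order of the steps). Names: a positive braid word $x$ determines a braid diagram with $n$ strands in which the successive letters $\sigma_i$ correspond to crossings of the strands currently at positions $i$ and $i+1$. If $e$ is an edge labeled $\sigma_i$ in a van Kampen diagram and $x$ is the word labeling a path from the source of the diagram to the source vertex of $e$, the name of $e$ is $\{p,q\}_a$, where $p,q$ are the initial positions of the strands that finish at positions $i$ and $i+1$ in the braid diagram of $x$, and $a-1$ is the number of times these two strands cross in that diagram (this does not depend on the choice of the path). A name is any symbol $\{p,q\}_a$ with $p\neq q$ in $\{1,\dots,n\}$ and $a\ge1$. In each face, the same names occur on the two bounding paths, in reversed order: two names for a square, and three names $\{p,q\}_a,\{p,r\}_b,\{q,r\}_c$ with $p,q,r$ pairwise distinct for a hexagon. Separatrices: for each name occurring in the diagram, the separatrix with that name is the curve, transversal to the edges, obtained by connecting, inside each face, the middles of the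 edges with that name. In each face, any two of the separatrices that traverse it cross exactly once (so two separatrices cross in a square and three separatrices pairwise cross in a hexagon). For a family of names $F$, an $F$-separatrix is a separatrix whose name belongs to $F$. A family $F$ of names is sparse if it contains no name of the form $\{p,r\}_c$ whenever it contains names $\{p,q\}_a$ and $\{q,r\}_b$ (with $p,q,r$ pairwise distinct). *)

theory Defs
  imports Main
begin

section \<open>Positive braid words and the combinatorial distance\<close>

text \<open>The letter \<open>i\<close> stands for the generator \<open>\<sigma>\<^sub>i\<close>.\<close>

definition positive_word :: "nat \<Rightarrow> nat list \<Rightarrow> bool" where
  "positive_word n w \<longleftrightarrow> set w \<subseteq> {1..<n}"

inductive braid_step :: "nat \<Rightarrow> nat list \<Rightarrow> nat list \<Rightarrow> bool" for n where
  commute: "i \<in> {1..<n} \<Longrightarrow> j \<in> {1..<n} \<Longrightarrow> \<bar>int i - int j\<bar> \<ge> 2 \<Longrightarrow>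
    braid_step n (x @ [i, j] @ y) (x @ [j, i] @ y)"
| braid: "i \<in> {1..<n} \<Longrightarrow> j \<in> {1..<n} \<Longrightarrow> \<bar>int i - int j\<bar> = 1 \<Longrightarrow>
    braid_step n (x @ [i, j, i] @ y) (x @ [j, i, j] @ y)"

text \<open>Only meaningful for equivalent words; the value is unspecified otherwise.\<close>

definition comb_dist :: "nat \<Rightarrow> nat list \<Rightarrow> nat list \<Rightarrow> nat" where
  "comb_dist n x y = (LEAST k. (braid_step n ^^ k) x y)"


section \<open>Right-reversing of signed words\<close>

datatype 'a signed = Pos 'a | Neg 'a

definition pos_word :: "'a list \<Rightarrow> 'a signed list" where
  "pos_word w = map Pos w"

definition inv_word :: "'a list \<Rightarrow> 'a signed list" where
  "inv_word w = map Neg (rev w)"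

inductive reverse_step :: "nat signed list \<Rightarrow> nat signed list \<Rightarrow> bool" where
  "\<bar>int i - int j\<bar> \<ge> 2 \<Longrightarrow>
    reverse_step (x @ [Neg i, Pos j] @ y) (x @ [Pos j, Neg i] @ y)"
| "\<bar>int i - int j\<bar> = 1 \<Longrightarrow>
    reverse_step (x @ [Neg i, Pos j] @ y) (x @ [Pos j, Pos i, Neg j, Neg i] @ y)"
| "reverse_step (x @ [Neg i, Pos i] @ y) (x @ y)"

abbreviation right_reverses :: "nat signed list \<Rightarrow> nat signed list \<Rightarrow> bool" where
  "right_reverses \<equiv> reverse_step\<^sup>*\<^sup>*"


section \<open>Reversing diagrams\<close>

datatype edge = Edge (src: nat) (lab: nat) (tgt: nat)

text \<open>
  A face is given by its two bounding paths, from the source of the face to its sink, the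
  first one being on the side of \<open>w\<close> and the second one on the side of \<open>w'\<close> in the diagram for
  \<open>w\<^sup>-\<^sup>1 w'\<close>. The frontier is the path in the diagram, from the end of \<open>w\<close> to the end of \<open>w'\<close>,
  that is labeled by the current signed word; \<open>Neg e\<close> means that \<open>e\<close> is traversed backwards.
  Faces form a list so that each nontrivial step contributes one face.
\<close>

record diagram =
  source :: nat
  edges :: "edge set"
  faces :: "(edge list \<times> edge list) list"
  frontier :: "edge signed list"

definition vertices :: "diagram \<Rightarrow> nat set" where
  "vertices D = insert (source D) (src ` edges D \<union> tgt ` edges D)"

abbreviation num_faces :: "diagram \<Rightarrow> nat" where
  "num_faces D \<equiv> length (faces D)"

definition frontier_word :: "diagram \<Rightarrow> nat signed list" where
  "frontier_word D = map (map_signed lab) (frontier D)"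

text \<open>The path labeled \<open>w\<close> that starts at \<open>u\<close> and then visits \<open>m\<close>, \<open>m + 1\<close>, \<dots>\<close>

fun chain :: "nat \<Rightarrow> nat \<Rightarrow> nat list \<Rightarrow> edge list" where
  "chain u m [] = []"
| "chain u m (i # w) = Edge u i m # chain m (Suc m) w"

definition initial_diagram :: "nat list \<Rightarrow> nat list \<Rightarrow> diagram" where
  "initial_diagram w w' =
    (let p = chain 0 1 w; p' = chain 0 (Suc (length w)) w' in
     \<lparr>source = 0, edges = set p \<union> set p', faces = [], frontier = inv_word p @ pos_word p'\<rparr>)"

definition rename_edge :: "(nat \<Rightarrow> nat) \<Rightarrow> edge \<Rightarrow> edge" where
  "rename_edge h e = Edge (h (src e)) (lab e) (h (tgt e))"

definition rename :: "(nat \<Rightarrow> nat) \<Rightarrow> diagram \<Rightarrow> diagram" where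
  "rename h D =
    \<lparr>source = h (source D),
     edges = rename_edge h ` edges D,
     faces = map (map_prod (map (rename_edge h)) (map (rename_edge h))) (faces D),
     frontier = map (map_signed (rename_edge h)) (frontier D)\<rparr>"

text \<open>
  The edges \<open>e\<close> and \<open>f\<close> below start from the same vertex, since they are consecutive in the
  frontier. In a trivial step they are identified by identifying their targets.
\<close>

inductive diagram_step :: "diagram \<Rightarrow> diagram \<Rightarrow> bool" where
  square:
    "frontier D = xs @ [Neg e, Pos f] @ ys \<Longrightarrow> \<bar>int (lab e) - int (lab f)\<bar> \<ge> 2 \<Longrightarrow>
     x \<notin> vertices D \<Longrightarrow>
     e\<^sub>1 = Edge (tgt e) (lab f) x \<Longrightarrow> f\<^sub>1 = Edge (tgt f) (lab e) x \<Longrightarrow>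
     diagram_step D
       (D\<lparr>edges := edges D \<union> {e\<^sub>1, f\<^sub>1},
          faces := faces D @ [([e, e\<^sub>1], [f, f\<^sub>1])],
          frontier := xs @ [Pos e\<^sub>1, Neg f\<^sub>1] @ ys\<rparr>)"
| hexagon:
    "frontier D = xs @ [Neg e, Pos f] @ ys \<Longrightarrow> \<bar>int (lab e) - int (lab f)\<bar> = 1 \<Longrightarrow>
     distinct [x, y, z] \<Longrightarrow> {x, y, z} \<inter> vertices D = {} \<Longrightarrow>
     e\<^sub>1 = Edge (tgt e) (lab f) x \<Longrightarrow> e\<^sub>2 = Edge x (lab e) z \<Longrightarrow>
     f\<^sub>1 = Edge (tgt f) (lab e) y \<Longrightarrow> f\<^sub>2 = Edge y (lab f) z \<Longrightarrow>
     diagram_step D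
       (D\<lparr>edges := edges D \<union> {e\<^sub>1, e\<^sub>2, f\<^sub>1, f\<^sub>2},
          faces := faces D @ [([e, e\<^sub>1, e\<^sub>2], [f, f\<^sub>1, f\<^sub>2])],
          frontier := xs @ [Pos e\<^sub>1, Pos e\<^sub>2, Neg f\<^sub>2, Neg f\<^sub>1] @ ys\<rparr>)"
| trivial:
    "frontier D = xs @ [Neg e, Pos f] @ ys \<Longrightarrow> lab e = lab f \<Longrightarrow>
     diagram_step D (rename (id(tgt f := tgt e)) (D\<lparr>frontier := xs @ ys\<rparr>))"

text \<open>
  The diagram of a complete reversing is unique up to the choice of the fresh vertices, of the
  representatives of identified vertices, and of the order in which the faces are listed.
\<close>

definition reversing_diagram :: "nat list \<Rightarrow> nat list \<Rightarrow> diagram \<Rightarrow> bool" where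
  "reversing_diagram w w' D \<longleftrightarrow>
    diagram_step\<^sup>*\<^sup>* (initial_diagram w w') D \<and>
    (\<exists>u u'. frontier_word D = pos_word u' @ inv_word u)"

inductive path :: "diagram \<Rightarrow> nat \<Rightarrow> nat list \<Rightarrow> nat \<Rightarrow> bool" for D where
  "u \<in> vertices D \<Longrightarrow> path D u [] u"
| "e \<in> edges D \<Longrightarrow> path D (tgt e) x v \<Longrightarrow> path D (src e) (lab e # x) v"


section \<open>Names\<close>

text \<open>The pair \<open>({p, q}, a)\<close> encodes the name \<open>{p, q}\<^sub>a\<close>.\<close>

type_synonym name = "nat set \<times> nat"

definition names :: "nat \<Rightarrow> name set" where
  "names n = {({p, q}, a) | p q a. p \<in> {1..n} \<and> q \<in> {1..n} \<and> p \<noteq> q \<and> a \<ge> 1}"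

text \<open>\<open>strand x i\<close> is the initial position of the strand that finishes at position \<open>i\<close> in the
  braid diagram of \<open>x\<close>.\<close>

definition strand :: "nat list \<Rightarrow> nat \<Rightarrow> nat" where
  "strand x = foldl (\<lambda>s i. s(i := s (Suc i), Suc i := s i)) id x"

definition crossing_strands :: "nat list \<Rightarrow> nat \<Rightarrow> nat set" where
  "crossing_strands x i = {strand x i, strand x (Suc i)}"

definition crossing_count :: "nat list \<Rightarrow> nat set \<Rightarrow> nat" where
  "crossing_count x P = card {k. k < length x \<and> crossing_strands (take k x) (x ! k) = P}"

definition letter_name :: "nat list \<Rightarrow> nat \<Rightarrow> name" where
  "letter_name x i =
    (crossing_strands x i, Suc (crossing_count x (crossing_strands x i)))"

definition edge_name :: "diagram \<Rightarrow> edge \<Rightarrow> name" where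
  "edge_name D e = (THE N. \<exists>x. path D (source D) x (src e) \<and> N = letter_name x (lab e))"

definition sparse :: "name set \<Rightarrow> bool" where
  "sparse F \<longleftrightarrow>
    (\<forall>p q r a b c. p \<noteq> q \<and> q \<noteq> r \<and> p \<noteq> r \<and> ({p, q}, a) \<in> F \<and> ({q, r}, b) \<in> F
       \<longrightarrow> ({p, r}, c) \<notin> F)"


section \<open>Separatrices and their crossings\<close>

text \<open>
  The part of the separatrix \<open>N\<close> inside the \<open>k\<close>-th face: the pair \<open>(p, q)\<close> stands for an arc
  that connects the middle of the \<open>p\<close>-th edge of the first bounding path of the face to the
  middle of the \<open>q\<close>-th edge of the second one.
\<close>

definition separatrix :: "diagram \<Rightarrow> name \<Rightarrow> nat \<Rightarrow> (nat \<times> nat) set" where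
  "separatrix D N k =
    {(p, q). p < length (fst (faces D ! k)) \<and> q < length (snd (faces D ! k)) \<and>
             edge_name D (fst (faces D ! k) ! p) = N \<and>
             edge_name D (snd (faces D ! k) ! q) = N}"

text \<open>Both bounding paths run from the source of the face to its sink, so two arcs cross when
  their ends come in opposite orders on the two paths.\<close>

definition arcs_cross :: "nat \<times> nat \<Rightarrow> nat \<times> nat \<Rightarrow> bool" where
  "arcs_cross = (\<lambda>(p, q) (p', q'). p < p' \<and> q' < q \<or> p' < p \<and> q < q')"

definition face_crossings :: "diagram \<Rightarrow> nat \<Rightarrow> name \<Rightarrow> name \<Rightarrow> (nat \<times> nat) set set" where
  "face_crossings D k N N' =
    {{\<alpha>, \<beta>} | \<alpha> \<beta>. \<alpha> \<in> separatrix D N k \<and> \<beta> \<in> separatrix D N' k \<and> arcs_cross \<alpha> \<beta>}"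

definition crossings :: "diagram \<Rightarrow> name \<Rightarrow> name \<Rightarrow> (nat \<times> (nat \<times> nat) set) set" where
  "crossings D N N' = (SIGMA k:{..<num_faces D}. face_crossings D k N N')"

definition one_crossing_per_face :: "diagram \<Rightarrow> name set \<Rightarrow> bool" where
  "one_crossing_per_face D F \<longleftrightarrow>
    (\<forall>k < num_faces D. card (\<Union>N\<in>F. \<Union>N'\<in>F - {N}. face_crossings D k N N') = 1)"

definition cross_at_most_once :: "diagram \<Rightarrow> name set \<Rightarrow> bool" where
  "cross_at_most_once D F \<longleftrightarrow>
    (\<forall>N\<in>F. \<forall>N'\<in>F. N \<noteq> N' \<longrightarrow> card (crossings D N N') \<le> 1)"

end

theory Submission
  imports Defs "HOL-Library.Multiset" "HOL-Library.Confluence"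
begin

text \<open>
  A braid relation reverses two or three consecutive names in the sequence of names of a word
  and leaves the rest of this sequence unchanged. The three names of a hexagon relation never
  all belong to a sparse family \<open>F\<close>, so each relation inverts at most one pair of names from
  \<open>F\<close>, and the distance is at least the number of such pairs that occur in opposite orders in
  \<open>w v'\<close> and \<open>w' v\<close>. Conversely the diagram yields a derivation from \<open>w v'\<close> to \<open>w' v\<close> with one
  relation per face, inverting exactly the pairs of names of that face. The pair of
  \<open>F\<close>-separatrices that cross in a given face cross in no other face, so it is inverted exactly
  once along this derivation; hence there are at least as many inverted pairs as faces.
\<close>

section \<open>Strand states and traces\<close>

text \<open>The obstacle is that an intermediate diagram has no sink: its frontier is a zigzag, so
  there are not yet two words between which its faces could give a derivation. The invariant is
  therefore a sweep along the frontier from \<open>w\<close> to \<open>w'\<close>: a word for the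
  current vertex is rewritten by braid relations, extended along positive edges and shortened along
  negative ones. At a corner the sweep derives \<open>a\<close> to \<open>t e\<close>, drops
  \<open>e\<close>, derives \<open>t\<close> to \<open>t'\<close> and goes on with
  \<open>t' f\<close>. Closing the corner by a face moves these relations under longer suffixes and
  adds exactly one; closing it by identification adds none. Once the frontier is positive and then
  inverse, the sweep unfolds to a derivation from \<open>w v'\<close> to \<open>w' v\<close>. Names
  depend on a vertex only through the state there, so no planar topology enters, and vertices may be
  identified as soon as their states agree. Inversion is measured by parity: in any derivation, two
  names change their relative order exactly when an odd number of relations reverse both. The same
  statement serves the derivation read off the diagram and an arbitrary competing one.\<close>

text \<open>The state reached by a braid word records the permutation of the strands and the number
  of crossings of each pair of strands. It determines the names of all subsequent letters.\<close>

type_synonym state = "(nat \<Rightarrow> nat) \<times> (nat set \<Rightarrow> nat)"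

definition name_at :: "state \<Rightarrow> nat \<Rightarrow> name" where
  "name_at s i = ({fst s i, fst s (Suc i)}, Suc (snd s {fst s i, fst s (Suc i)}))"

definition cross :: "state \<Rightarrow> nat \<Rightarrow> state" where
  "cross s i = ((fst s)(i := fst s (Suc i), Suc i := fst s i),
    (snd s)({fst s i, fst s (Suc i)} := Suc (snd s {fst s i, fst s (Suc i)})))"

definition state :: "nat list \<Rightarrow> state" where
  "state x = foldl cross (id, \<lambda>_. 0) x"

fun trace :: "state \<Rightarrow> nat list \<Rightarrow> name list" where
  "trace s [] = []"
| "trace s (i # x) = name_at s i # trace (cross s i) x"

abbreviation name_list :: "nat list \<Rightarrow> name list" where
  "name_list \<equiv> trace (state [])"

lemma state_append: "state (x @ y) = foldl cross (state x) y"
  by (simp add: state_def)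

lemma state_snoc [simp]: "state (x @ [i]) = cross (state x) i"
  by (simp add: state_def)

lemma trace_append: "trace s (x @ y) = trace s x @ trace (foldl cross s x) y"
  by (induction x arbitrary: s) auto

lemma name_list_append: "name_list (x @ y) = name_list x @ trace (state x) y"
  by (simp add: trace_append flip: state_append)

lemma crossing_count_snoc:
  "crossing_count (x @ [i]) P = crossing_count x P + (if crossing_strands x i = P then 1 else 0)"
proof -
  have "{k. k < length (x @ [i]) \<and> crossing_strands (take k (x @ [i])) ((x @ [i]) ! k) = P} =
    {k. k < length x \<and> crossing_strands (take k x) (x ! k) = P} \<union>
    (if crossing_strands x i = P then {length x} else {})"
    by (auto simp: less_Suc_eq nth_append)
  then show ?thesis
    by (simp add: crossing_count_def)
qed

text \<open>Replaces counting over prefixes by an update per letter, so that names can be computed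
  letter by letter.\<close>

lemma state_eq: "state x = (strand x, crossing_count x)"
proof (induction x rule: rev_induct)
  case Nil
  then show ?case
    by (simp add: state_def strand_def crossing_count_def fun_eq_iff)
next
  case (snoc i x)
  have "strand (x @ [i]) = (strand x)(i := strand x (Suc i), Suc i := strand x i)"
    by (simp add: strand_def)
  with snoc show ?case
    by (auto simp: cross_def crossing_count_snoc fun_eq_iff crossing_strands_def)
qed

lemma letter_name_eq: "letter_name x i = name_at (state x) i"
  by (simp add: letter_name_def name_at_def state_eq crossing_strands_def)

lemma inj_state: "inj (fst (state x))"
proof (induction x rule: rev_induct)
  case Nil
  then show ?case by (simp add: state_def)
next
  case (snoc i x)
  have "fst (cross s i) = fst s \<circ> id(i := Suc i, Suc i := i)" for s
    by (auto simp: cross_def fun_eq_iff)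
  moreover have "inj (id(i := Suc i, Suc i := i))"
    by (auto intro!: injI split: if_splits)
  ultimately show ?case
    using snoc inj_compose by (metis state_snoc)
qed

lemma name_list_bound: "(P, a) \<in> set (name_list x) \<Longrightarrow> a \<le> snd (state x) P"
proof (induction x rule: rev_induct)
  case (snoc i x)
  then show ?case
    by (auto simp: name_list_append name_at_def cross_def)
qed simp

text \<open>The index of a new name exceeds the number of earlier crossings of its pair, and that
  number bounds every earlier index of the same pair.\<close>

lemma distinct_name_list: "distinct (name_list x)"
proof (induction x rule: rev_induct)
  case (snoc i x)
  then show ?case
    using name_list_bound[of _ _ x]
    by (fastforce simp: name_list_append name_at_def)
qed simp

text \<open>The two letters move four different strands, so neither the positions nor the counters
  of one pair are touched by the other.\<close>

lemma far_letters:
  assumes "inj (fst s)" "\<bar>int i - int j\<bar> \<ge> 2"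
  shows "cross (cross s i) j = cross (cross s j) i"
    and "name_at (cross s i) j = name_at s j"
    and "name_at s i \<noteq> name_at s j"
proof -
  obtain f c where s: "s = (f, c)" by (cases s)
  have ne: "i \<noteq> j" "Suc i \<noteq> j" "i \<noteq> Suc j" using assms(2) by auto
  have P: "{f i, f (Suc i)} \<noteq> {f j, f (Suc j)}"
    using assms(1) ne by (auto simp: s doubleton_eq_iff inj_eq)
  show "cross (cross s i) j = cross (cross s j) i"
    using ne P by (auto simp: s cross_def fun_eq_iff)
  show "name_at (cross s i) j = name_at s j" "name_at s i \<noteq> name_at s j"
    using ne P by (auto simp: s cross_def name_at_def)
qed

text \<open>On either side of the relation each of the three pairs among three strands crosses
  exactly once, so the counters agree afterwards and only the order of the names is reversed. The
  form in which the names are given is the triangle forbidden by \<open>sparse\<close>.\<close>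

lemma adjacent_letters:
  assumes "inj (fst s)" "\<bar>int i - int j\<bar> = 1"
  shows "cross (cross (cross s i) j) i = cross (cross (cross s j) i) j" (is ?cross)
    and "trace s [j, i, j] = rev (trace s [i, j, i])" (is ?trace)
    and "\<exists>p q r a b c. p \<noteq> q \<and> q \<noteq> r \<and> p \<noteq> r \<and>
      trace s [i, j, i] = [({p, q}, a), ({p, r}, b), ({q, r}, c)]" (is ?names)
proof -
  obtain f c where s: "s = (f, c)" by (cases s)
  have *: "cross (cross (cross s i) (Suc i)) i = cross (cross (cross s (Suc i)) i) (Suc i)"
    "trace s [Suc i, i, Suc i] = rev (trace s [i, Suc i, i])"
    "\<exists>a b c. trace s [i, Suc i, i] = [({f i, f (Suc i)}, a), ({f i, f (Suc (Suc i))}, b),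
      ({f (Suc i), f (Suc (Suc i))}, c)]"
    "f i \<noteq> f (Suc i)" "f (Suc i) \<noteq> f (Suc (Suc i))" "f i \<noteq> f (Suc (Suc i))" for i
  proof -
    show d: "f i \<noteq> f (Suc i)" "f (Suc i) \<noteq> f (Suc (Suc i))" "f i \<noteq> f (Suc (Suc i))"
      using assms(1) by (simp_all add: s inj_eq)
    have P: "{f i, f (Suc i)} \<noteq> {f i, f (Suc (Suc i))}"
      "{f i, f (Suc i)} \<noteq> {f (Suc i), f (Suc (Suc i))}"
      "{f i, f (Suc (Suc i))} \<noteq> {f (Suc i), f (Suc (Suc i))}"
      using d by (auto simp: doubleton_eq_iff)
    let ?A = "{f i, f (Suc i)}" and ?B = "{f i, f (Suc (Suc i))}"
      and ?C = "{f (Suc i), f (Suc (Suc i))}"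
    note simps = cross_def name_at_def P P[symmetric]
    have i: "name_at s i = (?A, Suc (c ?A))"
      "cross s i = (f(i := f (Suc i), Suc i := f i), c(?A := Suc (c ?A)))"
      by (simp_all add: s simps)
    have ij: "name_at (cross s i) (Suc i) = (?B, Suc (c ?B))"
      "cross (cross s i) (Suc i) = (f(i := f (Suc i), Suc i := f (Suc (Suc i)), Suc (Suc i) := f i),
        c(?A := Suc (c ?A), ?B := Suc (c ?B)))"
      unfolding i by (simp_all add: simps)
    have iji: "name_at (cross (cross s i) (Suc i)) i = (?C, Suc (c ?C))"
      "cross (cross (cross s i) (Suc i)) i =
        (f(i := f (Suc (Suc i)), Suc i := f (Suc i), Suc (Suc i) := f i),
        c(?A := Suc (c ?A), ?B := Suc (c ?B), ?C := Suc (c ?C)))"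
      unfolding ij by (simp_all add: simps fun_upd_twist)
    have j: "name_at s (Suc i) = (?C, Suc (c ?C))"
      "cross s (Suc i) = (f(Suc i := f (Suc (Suc i)), Suc (Suc i) := f (Suc i)), c(?C := Suc (c ?C)))"
      by (simp_all add: s simps)
    have ji: "name_at (cross s (Suc i)) i = (?B, Suc (c ?B))"
      "cross (cross s (Suc i)) i =
        (f(i := f (Suc (Suc i)), Suc i := f i, Suc (Suc i) := f (Suc i)),
        c(?C := Suc (c ?C), ?B := Suc (c ?B)))"
      unfolding j by (simp_all add: simps fun_upd_twist)
    have jij: "name_at (cross (cross s (Suc i)) i) (Suc i) = (?A, Suc (c ?A))"
      "cross (cross (cross s (Suc i)) i) (Suc i) =
        (f(i := f (Suc (Suc i)), Suc i := f (Suc i), Suc (Suc i) := f i),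
        c(?C := Suc (c ?C), ?B := Suc (c ?B), ?A := Suc (c ?A)))"
      unfolding ji by (simp_all add: simps fun_upd_twist)
    have "c(?A := Suc (c ?A), ?B := Suc (c ?B), ?C := Suc (c ?C)) =
        c(?C := Suc (c ?C), ?B := Suc (c ?B), ?A := Suc (c ?A))"
      using P by (rule_tac ext) (simp only: fun_upd_apply split: if_split, blast)
    then show "cross (cross (cross s i) (Suc i)) i = cross (cross (cross s (Suc i)) i) (Suc i)"
      by (simp only: iji jij)
    show "trace s [Suc i, i, Suc i] = rev (trace s [i, Suc i, i])"
      by (simp add: i(1) ij(1) iji(1) j(1) ji(1) jij(1))
    show "\<exists>a b c. trace s [i, Suc i, i] = [(?A, a), (?B, b), (?C, c)]"
      by (simp add: i(1) ij(1) iji(1))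
  qed
  consider "j = Suc i" | "i = Suc j" using assms(2) by linarith
  then have "?cross \<and> ?trace \<and> ?names"
  proof cases
    case 1
    then show ?thesis using *[of i] by blast
  next
    case 2
    \<comment> \<open>The list of the first case is read backwards, which exchanges the two outer
      strands \<open>p\<close> and \<open>r\<close>.\<close>
    obtain a b c where "trace s [j, Suc j, j] =
        [({f j, f (Suc j)}, a), ({f j, f (Suc (Suc j))}, b), ({f (Suc j), f (Suc (Suc j))}, c)]"
      using *(3) by blast
    then have "trace s [i, j, i] = [({f (Suc (Suc j)), f (Suc j)}, c),
        ({f (Suc (Suc j)), f j}, b), ({f (Suc j), f j}, a)]"
      using *(2)[of j] 2 by (simp add: insert_commute)
    then have ?names using *(4-6)[of j] by metis
    moreover have ?trace using *(2)[of j] 2 by simp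
    ultimately show ?thesis using *(1)[of j] 2 by simp
  qed
  then show ?cross ?trace ?names by blast+
qed


section \<open>Braid steps and inverted pairs of names\<close>

definition face_names :: "name set \<Rightarrow> bool" where
  "face_names S \<longleftrightarrow> card S = 2 \<or>
    (\<exists>p q r a b c. p \<noteq> q \<and> q \<noteq> r \<and> p \<noteq> r \<and> S = {({p, q}, a), ({p, r}, b), ({q, r}, c)})"

text \<open>Equality of the states is part of the notion because it guarantees that all later
  letters keep their names.\<close>

definition named_step :: "nat \<Rightarrow> nat list \<Rightarrow> name set \<Rightarrow> nat list \<Rightarrow> bool" where
  "named_step n x S y \<longleftrightarrow> braid_step n x y \<and> state x = state y \<and> face_names S \<and>
    (\<exists>A M B. name_list x = A @ M @ B \<and> name_list y = A @ rev M @ B \<and> S = set M)"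

lemma braid_step_append: "braid_step n x y \<Longrightarrow> braid_step n (x @ z) (y @ z)"
proof (induction rule: braid_step.induct)
  case (commute i j x y)
  then show ?case using braid_step.commute[of i n j x "y @ z"] by simp
next
  case (braid i j x y)
  then show ?case using braid_step.braid[of i n j x "y @ z"] by simp
qed

lemma named_step_append:
  assumes "named_step n x S y"
  shows "named_step n (x @ z) S (y @ z)"
  using assms braid_step_append[of n x y z]
  unfolding named_step_def by (fastforce simp: name_list_append state_append)

lemma named_step_commute:
  assumes "i \<in> {1..<n}" "j \<in> {1..<n}" "\<bar>int i - int j\<bar> \<ge> 2"
  shows "named_step n (x @ [i, j]) (set (trace (state x) [i, j])) (x @ [j, i])"
proof -
  have far: "\<bar>int j - int i\<bar> \<ge> 2" using assms(3) by simp
  note f = far_letters[OF inj_state assms(3), of x] far_letters[OF inj_state far, of x]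
  have "trace (state x) [j, i] = rev (trace (state x) [i, j])"
    by (simp add: f(2,5))
  moreover have "face_names (set (trace (state x) [i, j]))"
    using f(3) by (simp add: face_names_def f(2))
  moreover have "name_list (x @ [i, j]) = name_list x @ trace (state x) [i, j] @ []"
    by (simp only: name_list_append append_Nil2)
  moreover have "name_list (x @ [j, i]) = name_list x @ rev (trace (state x) [i, j]) @ []"
    by (simp only: name_list_append append_Nil2 calculation(1))
  moreover have "braid_step n (x @ [i, j]) (x @ [j, i])"
    using braid_step.commute[OF assms, of x "[]"] by simp
  moreover have "state (x @ [i, j]) = state (x @ [j, i])"
    by (simp add: state_append f(1))
  ultimately show ?thesis
    unfolding named_step_def by (intro conjI exI) (assumption | rule refl)+
qed

lemma named_step_braid:
  assumes "i \<in> {1..<n}" "j \<in> {1..<n}" "\<bar>int i - int j\<bar> = 1"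
  shows "named_step n (x @ [i, j, i]) (set (trace (state x) [i, j, i])) (x @ [j, i, j])"
proof -
  note a = adjacent_letters[OF inj_state assms(3), of x]
  have "face_names (set (trace (state x) [i, j, i]))"
    unfolding face_names_def using a(3) by (metis list.simps(15) empty_set)
  moreover have "name_list (x @ [i, j, i]) = name_list x @ trace (state x) [i, j, i] @ []"
    "name_list (x @ [j, i, j]) = name_list x @ rev (trace (state x) [i, j, i]) @ []"
    by (simp_all only: name_list_append a(2) append_Nil2)
  moreover have "braid_step n (x @ [i, j, i]) (x @ [j, i, j])"
    using braid_step.braid[OF assms, of x "[]"] by simp
  moreover have "state (x @ [i, j, i]) = state (x @ [j, i, j])"
    by (simp add: state_append a(1))
  ultimately show ?thesis
    unfolding named_step_def by (intro conjI exI) (assumption | rule refl)+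
qed

text \<open>The relation is applied at the end of the prefix; the remaining letters are appended
  afterwards and are named alike on both sides.\<close>

lemma braid_step_named: "braid_step n x y \<Longrightarrow> \<exists>S. named_step n x S y"
proof (induction rule: braid_step.induct)
  case (commute i j x y)
  show ?case
    using named_step_append[OF named_step_commute[OF commute], of x y]
    unfolding append_assoc by (rule exI)
next
  case (braid i j x y)
  show ?case
    using named_step_append[OF named_step_braid[OF braid], of x y]
    unfolding append_assoc by (rule exI)
qed

section \<open>Relative order of names and its inversion along derivations\<close>

fun prec :: "'a list \<Rightarrow> ('a \<times> 'a) set" where
  "prec [] = {}"
| "prec (a # x) = {a} \<times> set x \<union> prec x"

lemma prec_append: "prec (x @ y) = prec x \<union> prec y \<union> set x \<times> set y"
  by (induction x) auto

lemma prec_rev: "prec (rev x) = (prec x)\<inverse>"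
  by (induction x) (auto simp: prec_append)

lemma prec_subset: "(a, b) \<in> prec x \<Longrightarrow> a \<in> set x \<and> b \<in> set x"
  by (induction x) auto

lemma prec_total: "a \<in> set x \<Longrightarrow> b \<in> set x \<Longrightarrow> a \<noteq> b \<Longrightarrow> (a, b) \<in> prec x \<or> (b, a) \<in> prec x"
  by (induction x) auto

lemma prec_asym: "distinct x \<Longrightarrow> (a, b) \<in> prec x \<Longrightarrow> (b, a) \<notin> prec x"
  by (induction x) (auto dest: prec_subset)

text \<open>Reversing the block \<open>M\<close> inverts exactly the pairs inside it. Since the
  names of a word are distinct, a pair cannot occur in both orders, so inverting it changes its
  membership in \<open>prec\<close>.\<close>

lemma named_step_flip:
  assumes "named_step n x S y" "N \<noteq> N'"
  shows "((N, N') \<in> prec (name_list x) \<longleftrightarrow> (N, N') \<in> prec (name_list y)) \<longleftrightarrow> \<not> {N, N'} \<subseteq> S"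
proof -
  obtain A M B where *: "name_list x = A @ M @ B" "name_list y = A @ rev M @ B" "S = set M"
    using assms unfolding named_step_def by blast
  have d: "distinct (A @ M @ B)" "distinct (A @ rev M @ B)"
    using distinct_name_list *(1,2) by metis+
  show ?thesis
  proof (cases "{N, N'} \<subseteq> S")
    case False
    then show ?thesis
      unfolding * by (auto simp: prec_append prec_rev *(3) dest: prec_subset)
  next
    case True
    then have "(N, N') \<in> prec M \<or> (N', N) \<in> prec M"
      using prec_total[of N M N'] assms(2) *(3) by auto
    then have "(N, N') \<in> prec (A @ M @ B) \<and> (N', N) \<in> prec (A @ rev M @ B) \<or>
      (N', N) \<in> prec (A @ M @ B) \<and> (N, N') \<in> prec (A @ rev M @ B)"
      by (auto simp: prec_append prec_rev)
    with prec_asym[OF d(1)] prec_asym[OF d(2)] True show ?thesis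
      unfolding * by metis
  qed
qed

text \<open>A multiset is carried because the same name set may be reversed several times: its size
  is the length of the derivation, and multiplicities decide parities.\<close>

inductive deriv :: "nat \<Rightarrow> nat list \<Rightarrow> name set multiset \<Rightarrow> nat list \<Rightarrow> bool" for n where
  empty: "deriv n x {#} x"
| step: "named_step n x S y \<Longrightarrow> deriv n y M z \<Longrightarrow> deriv n x (add_mset S M) z"

lemma deriv_trans: "deriv n x M y \<Longrightarrow> deriv n y M' z \<Longrightarrow> deriv n x (M + M') z"
  by (induction rule: deriv.induct) (auto intro: deriv.intros)

lemma deriv_append: "deriv n x M y \<Longrightarrow> deriv n (x @ z) M (y @ z)"
  by (induction rule: deriv.induct) (auto intro: deriv.intros named_step_append)

lemma deriv_single: "named_step n x S y \<Longrightarrow> deriv n x {#S#} y"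
  using deriv.intros by blast

lemma deriv_state: "deriv n x M y \<Longrightarrow> state x = state y"
  by (induction rule: deriv.induct) (auto simp: named_step_def)

lemma deriv_face_names: "deriv n x M y \<Longrightarrow> S \<in># M \<Longrightarrow> face_names S"
  by (induction rule: deriv.induct) (auto simp: named_step_def)

lemma deriv_relpowp: "deriv n x M y \<Longrightarrow> (braid_step n ^^ size M) x y"
  by (induction rule: deriv.induct)
    (auto simp: named_step_def simp del: relpowp.simps(2) intro: relpowp_Suc_I2)

lemma relpowp_deriv: "(braid_step n ^^ k) x y \<Longrightarrow> \<exists>M. deriv n x M y \<and> size M = k"
proof (induction k arbitrary: x)
  case 0
  then show ?case by (auto intro: deriv.empty)
next
  case (Suc k)
  obtain z where z: "braid_step n x z" "(braid_step n ^^ k) z y"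
    using Suc.prems by (rule relpowp_Suc_E2)
  with Suc.IH obtain M where "deriv n z M y" "size M = k" by blast
  moreover obtain S where "named_step n x S z" using braid_step_named z(1) by blast
  ultimately show ?case by (metis deriv.step size_add_mset)
qed

text \<open>Each relation that reverses both names switches their order, and every other relation
  preserves it.\<close>

lemma deriv_parity:
  assumes "deriv n x M y" "N \<noteq> N'"
  shows "((N, N') \<in> prec (name_list x) \<longleftrightarrow> (N, N') \<in> prec (name_list y)) \<longleftrightarrow>
    even (size (filter_mset (\<lambda>S. {N, N'} \<subseteq> S) M))"
  using assms(1)
proof (induction rule: deriv.induct)
  case (step x S y M z)
  then show ?case
    using named_step_flip[OF step(1) assms(2)] by auto
qed simp

text \<open>A third name of \<open>F\<close> in \<open>S\<close> would complete a triangle. Hence a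
  relation determines the pair of names of \<open>F\<close> that it inverts.\<close>

lemma sparse_face_names:
  assumes "sparse F" "face_names S" "N \<noteq> N'" "{N, N'} \<subseteq> S \<inter> F"
  shows "S \<inter> F = {N, N'}"
proof (cases "card S = 2")
  case True
  then have "finite S" using card.infinite by fastforce
  then have "S = {N, N'}"
    using True assms(3,4) by (metis card_2_iff card_seteq inf.bounded_iff order_refl)
  then show ?thesis using assms(4) by auto
next
  case False
  then obtain p q r a b c where S: "p \<noteq> q" "q \<noteq> r" "p \<noteq> r"
    "S = {({p, q}, a), ({p, r}, b), ({q, r}, c)}"
    using assms(2) unfolding face_names_def by metis
  have "\<not> (({p, q}, a) \<in> F \<and> ({q, r}, c) \<in> F \<and> ({p, r}, b) \<in> F)"
    using assms(1) S(1-3) unfolding sparse_def by blast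
  with assms(3,4) show ?thesis unfolding S(4) by auto
qed

text \<open>An inverted pair is reversed an odd number of times, hence by at least one relation, and
  it is then the trace \<open>S \<inter> F\<close> of the name set of that relation. So the pairs
  are the images of at most \<open>k\<close> name sets under intersection with
  \<open>F\<close>.\<close>

lemma sparse_lower_bound:
  assumes "sparse F" "(braid_step n ^^ k) x y"
    and "\<And>P. P \<in> \<P> \<Longrightarrow> \<exists>N N'. P = {N, N'} \<and> N \<noteq> N' \<and> {N, N'} \<subseteq> F \<and>
      ((N, N') \<in> prec (name_list x) \<longleftrightarrow> (N, N') \<notin> prec (name_list y))"
  shows "card \<P> \<le> k"
proof -
  obtain M where M: "deriv n x M y" "size M = k" using relpowp_deriv assms(2) by blast
  have "\<P> \<subseteq> (\<lambda>S. S \<inter> F) ` set_mset M"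
  proof
    fix P assume "P \<in> \<P>"
    with assms(3) obtain N N' where P: "P = {N, N'}" "N \<noteq> N'" "{N, N'} \<subseteq> F"
      "(N, N') \<in> prec (name_list x) \<longleftrightarrow> (N, N') \<notin> prec (name_list y)" by metis
    with deriv_parity[OF M(1) P(2)] have "odd (size (filter_mset (\<lambda>S. {N, N'} \<subseteq> S) M))"
      by blast
    then have "filter_mset (\<lambda>S. {N, N'} \<subseteq> S) M \<noteq> {#}"
      by (metis even_zero size_empty)
    then obtain S where "S \<in># filter_mset (\<lambda>S. {N, N'} \<subseteq> S) M"
      by (rule multiset_nonemptyE)
    then have S: "S \<in># M" "{N, N'} \<subseteq> S" by auto
    with P sparse_face_names[OF assms(1) deriv_face_names[OF M(1)], of S N N']
    have "S \<inter> F = P" by auto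
    with S show "P \<in> (\<lambda>S. S \<inter> F) ` set_mset M" by blast
  qed
  then have "card \<P> \<le> card (set_mset M)" by (meson finite_set_mset surj_card_le)
  also have "\<dots> \<le> k"
    using M(2) mset_subset_eqI size_mset_set size_mset_mono mset_set_set_mset_msubset by metis
  finally show ?thesis .
qed


section \<open>Confluence of right-reversing\<close>

text \<open>One right-hand side for all three rules, so that the diamond argument does not split by
  rule.\<close>

definition reversed :: "nat \<Rightarrow> nat \<Rightarrow> nat signed list" where
  "reversed i j = (if i = j then [] else if \<bar>int i - int j\<bar> = 1
    then [Pos j, Pos i, Neg j, Neg i] else [Pos j, Neg i])"

lemma reverse_step_iff: "reverse_step a b \<longleftrightarrow>
  (\<exists>x i j y. a = x @ [Neg i, Pos j] @ y \<and> b = x @ reversed i j @ y)"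
proof
  assume "reverse_step a b"
  then show "\<exists>x i j y. a = x @ [Neg i, Pos j] @ y \<and> b = x @ reversed i j @ y"
  proof cases
    case (1 i j x y)
    then have "reversed i j = [Pos j, Neg i]" by (auto simp: reversed_def)
    with 1 show ?thesis by metis
  next
    case (2 i j x y)
    then have "reversed i j = [Pos j, Pos i, Neg j, Neg i]" by (auto simp: reversed_def)
    with 2 show ?thesis by metis
  next
    case (3 x i y)
    then have "b = x @ reversed i i @ y" by (auto simp: reversed_def)
    with 3 show ?thesis by metis
  qed
next
  assume "\<exists>x i j y. a = x @ [Neg i, Pos j] @ y \<and> b = x @ reversed i j @ y"
  then obtain x i j y where *: "a = x @ [Neg i, Pos j] @ y" "b = x @ reversed i j @ y" by blast
  consider "i = j" | "\<bar>int i - int j\<bar> = 1" | "\<bar>int i - int j\<bar> \<ge> 2" by linarith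
  then show "reverse_step a b"
  proof cases
    case 1
    then show ?thesis using * reverse_step.intros(3)[of x i y] by (simp add: reversed_def)
  next
    case 2
    then show ?thesis using * reverse_step.intros(2)[of i j x y] by (auto simp: reversed_def)
  next
    case 3
    then show ?thesis using * reverse_step.intros(1)[of i j x y] by (auto simp: reversed_def)
  qed
qed

text \<open>Two corners of one word coincide or are disjoint, since an overlap in a single letter
  would make it both positive and negative. Disjoint corners are reversed independently.\<close>

lemma reverse_step_diamond:
  assumes "reverse_step a b" "reverse_step a c"
  shows "b = c \<or> (\<exists>d. reverse_step b d \<and> reverse_step c d)"
proof -
  have apart: "\<exists>d. reverse_step (x @ reversed i j @ z @ [Neg i', Pos j'] @ y) d \<and>
      reverse_step (x @ [Neg i, Pos j] @ z @ reversed i' j' @ y) d" for x i j z i' j' y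
    unfolding reverse_step_iff
    by (rule exI[of _ "x @ reversed i j @ z @ reversed i' j' @ y"]) (metis append.assoc)
  obtain x i j y where 1: "a = x @ [Neg i, Pos j] @ y" "b = x @ reversed i j @ y"
    using assms(1) unfolding reverse_step_iff by blast
  obtain x' i' j' y' where 2: "a = x' @ [Neg i', Pos j'] @ y'" "c = x' @ reversed i' j' @ y'"
    using assms(2) unfolding reverse_step_iff by blast
  have "x @ [Neg i, Pos j] @ y = x' @ [Neg i', Pos j'] @ y'" using 1 2 by simp
  then obtain z where "x = x' @ z \<and> z @ [Neg i, Pos j] @ y = [Neg i', Pos j'] @ y' \<or>
      x @ z = x' \<and> [Neg i, Pos j] @ y = z @ [Neg i', Pos j'] @ y'"
    by (auto simp: append_eq_append_conv2)
  then consider "x = x'" "i = i'" "j = j'" "y = y'"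
    | z' where "x = x' @ [Neg i', Pos j'] @ z'" "y' = z' @ [Neg i, Pos j] @ y"
    | z' where "x' = x @ [Neg i, Pos j] @ z'" "y = z' @ [Neg i', Pos j'] @ y'"
    by (cases z; cases "tl z") (auto simp: Cons_eq_append_conv)
  then show ?thesis
  proof cases
    case 1
    then show ?thesis using \<open>b = _\<close> \<open>c = _\<close> by simp
  next
    case (2 z')
    then show ?thesis using apart[of x' i' j' z' i j y] \<open>b = _\<close> \<open>c = _\<close> by auto
  next
    case (3 z')
    then show ?thesis using apart[of x i j z' i' j' y'] \<open>b = _\<close> \<open>c = _\<close> by auto
  qed
qed

lemma pos_inv_irreducible: "\<not> reverse_step (pos_word p @ inv_word q) a"
proof
  assume "reverse_step (pos_word p @ inv_word q) a"
  then obtain x i j y where "pos_word p @ inv_word q = x @ [Neg i, Pos j] @ y"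
    unfolding reverse_step_iff by blast
  then show False
    by (auto simp: pos_word_def inv_word_def append_eq_append_conv2 map_eq_append_conv
      append_eq_map_conv Cons_eq_append_conv Cons_eq_map_conv append_eq_Cons_conv)
qed

lemma pos_inv_eq_iff:
  "pos_word p @ inv_word q = pos_word p' @ inv_word q' \<longleftrightarrow> p = p' \<and> q = q'"
proof -
  have "map Pos p @ map Neg q = map Pos p' @ map Neg q' \<longleftrightarrow> p = p' \<and> q = q'" for q q' :: "'a list"
  proof (induction p arbitrary: p')
    case Nil
    then show ?case by (cases p'; cases q) (auto simp: inj_map_eq_map inj_def)
  next
    case (Cons a p)
    then show ?case by (cases p'; cases q') auto
  qed
  then show ?thesis by (simp add: pos_word_def inv_word_def)
qed

text \<open>Links the given words \<open>v\<close>, \<open>v'\<close> to the final frontier of the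
  diagram, which may arise from another order of the steps. Both ends are irreducible, so a common
  reduct equals each of them.\<close>

lemma right_reverses_unique:
  assumes "right_reverses a (pos_word p @ inv_word q)" "right_reverses a (pos_word p' @ inv_word q')"
  shows "p = p' \<and> q = q'"
proof -
  have "strong_confluentp reverse_step"
  proof
    fix a b c assume "reverse_step a b" "reverse_step a c"
    then show "\<exists>d. right_reverses b d \<and> reverse_step\<^sup>=\<^sup>= c d"
      using reverse_step_diamond[of a b c] by auto
  qed
  then have "confluentp reverse_step" by (rule strong_confluentp_imp_confluentp)
  then obtain d where "right_reverses (pos_word p @ inv_word q) d"
    "right_reverses (pos_word p' @ inv_word q') d"
    using assms by (blast dest: confluentpD)
  then show ?thesis
    using pos_inv_irreducible pos_inv_eq_iff by (metis converse_rtranclpE)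
qed


section \<open>Reversing diagrams as derivations\<close>

text \<open>Here \<open>W\<close> assigns to each vertex the common state of all paths from the source to it. A
  frontier is swept from left to right, following its edges and inserting braid steps between
  them, while a word for the current vertex is maintained.\<close>

inductive sweep :: "nat \<Rightarrow> (nat \<Rightarrow> state) \<Rightarrow> nat list \<Rightarrow> edge signed list \<Rightarrow> nat list \<Rightarrow>
    name set multiset \<Rightarrow> bool" for n W where
  nil: "sweep n W u [] u {#}"
| step: "named_step n u S t \<Longrightarrow> sweep n W t s u' M \<Longrightarrow> sweep n W u s u' (add_mset S M)"
| pos: "state u = W (src e) \<Longrightarrow> sweep n W (u @ [lab e]) s u' M \<Longrightarrow> sweep n W u (Pos e # s) u' M"
| neg: "state t = W (src e) \<Longrightarrow> sweep n W t s u' M \<Longrightarrow> sweep n W (t @ [lab e]) (Neg e # s) u' M"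

lemma deriv_sweep: "deriv n u M t \<Longrightarrow> sweep n W t s u' M' \<Longrightarrow> sweep n W u s u' (M + M')"
  by (induction rule: deriv.induct) (auto intro: sweep.intros)

lemma sweep_append:
  "sweep n W u xs t M \<Longrightarrow> sweep n W t ys u' M' \<Longrightarrow> sweep n W u (xs @ ys) u' (M + M')"
  by (induction rule: sweep.induct) (auto intro: sweep.intros)

lemma sweep_appendE:
  assumes "sweep n W u (xs @ ys) u' M"
  obtains t M\<^sub>1 M\<^sub>2 where "sweep n W u xs t M\<^sub>1" "sweep n W t ys u' M\<^sub>2" "M = M\<^sub>1 + M\<^sub>2"
proof -
  have "\<exists>t M\<^sub>1 M\<^sub>2. sweep n W u xs t M\<^sub>1 \<and> sweep n W t ys u' M\<^sub>2 \<and> M = M\<^sub>1 + M\<^sub>2"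
    using assms
  proof (induction u "xs @ ys" u' M arbitrary: xs rule: sweep.induct)
    case (nil u)
    then show ?case using sweep.nil by fastforce
  next
    case (step u S t u' M)
    then obtain r M\<^sub>1 M\<^sub>2 where "sweep n W t xs r M\<^sub>1" "sweep n W r ys u' M\<^sub>2" "M = M\<^sub>1 + M\<^sub>2"
      by blast
    then show ?case
      using sweep.step[OF step(1)] by (metis union_mset_add_mset_left)
  next
    case (pos u e s u' M)
    show ?case
    proof (cases xs)
      case Nil
      then show ?thesis
        using sweep.nil[of n W u] sweep.pos[of u W e, OF pos(1,2)] pos(4) by fastforce
    next
      case (Cons g xs')
      then have g: "g = Pos e" "s = xs' @ ys" using pos(4) by auto
      with pos(3) obtain r M\<^sub>1 M\<^sub>2 where "sweep n W (u @ [lab e]) xs' r M\<^sub>1"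
        "sweep n W r ys u' M\<^sub>2" "M = M\<^sub>1 + M\<^sub>2" by blast
      then show ?thesis unfolding Cons g using sweep.pos[where e = e and W = W, OF pos(1)] by blast
    qed
  next
    case (neg t e s u' M)
    show ?case
    proof (cases xs)
      case Nil
      then show ?thesis
        using sweep.nil[of n W "t @ [lab e]"] sweep.neg[of t W e, OF neg(1,2)] neg(4) by fastforce
    next
      case (Cons g xs')
      then have g: "g = Neg e" "s = xs' @ ys" using neg(4) by auto
      with neg(3) obtain r M\<^sub>1 M\<^sub>2 where "sweep n W t xs' r M\<^sub>1"
        "sweep n W r ys u' M\<^sub>2" "M = M\<^sub>1 + M\<^sub>2" by blast
      then show ?thesis unfolding Cons g using sweep.neg[where e = e and W = W, OF neg(1)] by blast
    qed
  qed
  then show thesis using that by blast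
qed

lemma sweep_posE:
  assumes "sweep n W u (Pos e # s) u' M"
  obtains t M\<^sub>1 M\<^sub>2 where "deriv n u M\<^sub>1 t" "state t = W (src e)" "sweep n W (t @ [lab e]) s u' M\<^sub>2"
    "M = M\<^sub>1 + M\<^sub>2"
proof -
  have "\<exists>t M\<^sub>1 M\<^sub>2. deriv n u M\<^sub>1 t \<and> state t = W (src e) \<and> sweep n W (t @ [lab e]) s u' M\<^sub>2 \<and>
      M = M\<^sub>1 + M\<^sub>2"
    using assms
  proof (induction u "Pos e # s" u' M rule: sweep.induct)
    case (step u S t u' M)
    then show ?case using deriv.step by (metis union_mset_add_mset_left)
  next
    case (pos u u' M)
    then show ?case using deriv.empty by fastforce
  qed
  then show thesis using that by blast
qed

lemma sweep_negE:
  assumes "sweep n W u (Neg e # s) u' M"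
  obtains t M\<^sub>1 M\<^sub>2 where "deriv n u M\<^sub>1 (t @ [lab e])" "state t = W (src e)" "sweep n W t s u' M\<^sub>2"
    "M = M\<^sub>1 + M\<^sub>2"
proof -
  have "\<exists>t M\<^sub>1 M\<^sub>2. deriv n u M\<^sub>1 (t @ [lab e]) \<and> state t = W (src e) \<and> sweep n W t s u' M\<^sub>2 \<and>
      M = M\<^sub>1 + M\<^sub>2"
    using assms
  proof (induction u "Neg e # s" u' M rule: sweep.induct)
    case (step u S t u' M)
    then show ?case using deriv.step by (metis union_mset_add_mset_left)
  next
    case (neg t u' M)
    then show ?case using deriv.empty by fastforce
  qed
  then show thesis using that by blast
qed

text \<open>\<open>P\<close> collects the relations applied before \<open>e\<close> is traversed
  backwards, and \<open>Q\<close> those applied at the common source, between \<open>e\<close> and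
  \<open>f\<close>.\<close>

lemma sweep_cornerE:
  assumes "sweep n W u (xs @ [Neg e, Pos f] @ ys) u' M"
  obtains a t t' b L P Q R K where "sweep n W u xs a L" "deriv n a P (t @ [lab e])"
    "state t = W (src e)" "deriv n t Q t'" "state t' = W (src f)" "deriv n (t' @ [lab f]) R b"
    "sweep n W b ys u' K" "M = L + (P + Q + R) + K"
proof -
  obtain a L M\<^sub>1 where 1: "sweep n W u xs a L" "sweep n W a (Neg e # Pos f # ys) u' M\<^sub>1" "M = L + M\<^sub>1"
    using sweep_appendE[OF assms] by auto
  obtain t P M\<^sub>2 where 2: "deriv n a P (t @ [lab e])" "state t = W (src e)"
    "sweep n W t (Pos f # ys) u' M\<^sub>2" "M\<^sub>1 = P + M\<^sub>2"
    using 1(2) by (rule sweep_negE)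
  obtain t' Q K where 3: "deriv n t Q t'" "state t' = W (src f)"
    "sweep n W (t' @ [lab f]) ys u' K" "M\<^sub>2 = Q + K"
    using 2(3) by (rule sweep_posE)
  \<comment> \<open>\<open>R\<close> is taken empty and \<open>b\<close> is
    \<open>t' @ [lab f]\<close>: relations applied after \<open>f\<close> stay in the sweep of
    \<open>ys\<close>.\<close>
  have "M = L + (P + Q + {#}) + K" using 1(3) 2(4) 3(4) by (simp add: ac_simps)
  then show thesis by (rule that[OF 1(1) 2(1,2) 3(1,2) deriv.empty 3(3)])
qed

definition underlying :: "edge signed list \<Rightarrow> edge set" where
  "underlying s = {e. Pos e \<in> set s \<or> Neg e \<in> set s}"

lemma underlying_simps [simp]:
  "underlying [] = {}"
  "underlying (Pos e # s) = insert e (underlying s)"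
  "underlying (Neg e # s) = insert e (underlying s)"
  "underlying (s @ s') = underlying s \<union> underlying s'"
  "underlying (pos_word p) = set p"
  "underlying (inv_word p) = set p"
  by (auto simp: underlying_def pos_word_def inv_word_def)

lemma underlying_map [simp]: "underlying (map (map_signed g) s) = g ` underlying s"
proof (induction s)
  case (Cons a s)
  then show ?case by (cases a) auto
qed simp

text \<open>A sweep sees an edge only through its label and the state at its source.\<close>

lemma sweep_map:
  assumes "sweep n W u s u' M"
    and "\<And>e. e \<in> underlying s \<Longrightarrow> W' (src (g e)) = W (src e) \<and> lab (g e) = lab e"
  shows "sweep n W' u (map (map_signed g) s) u' M"
  using assms
proof (induction rule: sweep.induct)
  case (pos u e s u' M)
  then show ?case using sweep.pos[of u W' "g e"] by simp
next
  case (neg t e s u' M)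
  then show ?case using sweep.neg[of t W' "g e"] by simp
qed (auto intro: sweep.intros)

lemma sweep_cong:
  assumes "sweep n W u s u' M" and "\<And>e. e \<in> underlying s \<Longrightarrow> W' (src e) = W (src e)"
  shows "sweep n W' u s u' M"
  using sweep_map[OF assms(1), of W' id] assms(2) by (simp add: signed.map_id0)

text \<open>The letters still to be read are kept as a suffix from the start, so that traversing an
  edge changes nothing.\<close>

lemma sweep_pos_word:
  "sweep n W u s u' M \<Longrightarrow> map (map_signed lab) s = pos_word p \<Longrightarrow> deriv n (u @ p) M u'"
proof (induction arbitrary: p rule: sweep.induct)
  case (step u S t s u' M)
  then show ?case using deriv.step named_step_append by blast
next
  case (pos u e s u' M)
  then obtain p' where "p = lab e # p'" "map (map_signed lab) s = pos_word p'"
    by (auto simp: pos_word_def Cons_eq_map_conv)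
  then show ?case using pos(3) by fastforce
qed (auto simp: pos_word_def intro: deriv.empty)

text \<open>Dually, each letter dropped by the sweep is put back as a suffix of the words that
  follow.\<close>

lemma sweep_inv_word:
  "sweep n W u s u' M \<Longrightarrow> map (map_signed lab) s = inv_word q \<Longrightarrow> deriv n u M (u' @ q)"
proof (induction arbitrary: q rule: sweep.induct)
  case (step u S t s u' M)
  then show ?case using deriv.step by blast
next
  case (neg t e s u' M)
  then obtain q' where "rev q = lab e # q'" "map (map_signed lab) s = map Neg q'"
    by (auto simp: inv_word_def Cons_eq_map_conv)
  then have "q = rev q' @ [lab e]" "map (map_signed lab) s = inv_word (rev q')"
    by (metis rev.simps(2) rev_rev_ident) (simp add: inv_word_def \<open>map (map_signed lab) s = _\<close>)
  then show ?case using deriv_append[OF neg(3), of "rev q'" "[lab e]"] by simp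
qed (auto simp: inv_word_def intro: deriv.empty)

section \<open>The invariant of the construction of the diagram\<close>

definition name_in :: "(nat \<Rightarrow> state) \<Rightarrow> edge \<Rightarrow> name" where
  "name_in W e = name_at (W (src e)) (lab e)"

text \<open>The local condition on edges forces all paths to a vertex to end in the same state.
  Reachability provides a path for the definite description in \<open>edge_name\<close>. The sweep
  uses one braid relation per face, with the names of that face.\<close>

definition represents :: "nat \<Rightarrow> nat list \<Rightarrow> nat list \<Rightarrow> diagram \<Rightarrow> (nat \<Rightarrow> state) \<Rightarrow> bool" where
  "represents n w w' D W \<longleftrightarrow>
    W (source D) = state [] \<and>
    (\<forall>e\<in>edges D. W (tgt e) = cross (W (src e)) (lab e) \<and> lab e \<in> {1..<n}) \<and>
    (\<forall>v\<in>vertices D. \<exists>x. path D (source D) x v) \<and>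
    underlying (frontier D) \<subseteq> edges D \<and>
    (\<forall>(p, q)\<in>set (faces D). set p \<union> set q \<subseteq> edges D \<and>
      map (name_in W) q = rev (map (name_in W) p) \<and> distinct (map (name_in W) p)) \<and>
    sweep n W w (frontier D) w' (mset (map (\<lambda>(p, q). name_in W ` set p) (faces D)))"

lemma path_trans: "path D u x v \<Longrightarrow> path D v y t \<Longrightarrow> path D u (x @ y) t"
  by (induction rule: path.induct) (auto intro: path.intros)

lemma path_edge: "e \<in> edges D \<Longrightarrow> path D (src e) [lab e] (tgt e)"
  by (rule path.intros(2)) (auto intro!: path.intros(1) simp: vertices_def)

lemma path_mono:
  "path D u x v \<Longrightarrow> edges D \<subseteq> edges D' \<Longrightarrow> source D = source D' \<Longrightarrow> path D' u x v"
  by (induction rule: path.induct) (auto intro!: path.intros simp: vertices_def)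

lemma path_source_state:
  assumes "represents n w w' D W"
  shows "path D u x v \<Longrightarrow> W v = foldl cross (W u) x"
  by (induction rule: path.induct) (use assms in \<open>auto simp: represents_def\<close>)

lemma edge_name_represents:
  assumes "represents n w w' D W" "e \<in> edges D"
  shows "edge_name D e = name_in W e"
proof -
  have *: "letter_name x (lab e) = name_in W e" if "path D (source D) x (src e)" for x
  proof -
    have "W (src e) = state x"
      using path_source_state[OF assms(1) that] assms(1) state_append[of "[]" x]
      by (simp add: represents_def)
    then show ?thesis by (simp add: letter_name_eq name_in_def)
  qed
  have "src e \<in> vertices D" using assms(2) by (auto simp: vertices_def)
  then obtain x where "path D (source D) x (src e)" using assms(1) unfolding represents_def by blast
  then show ?thesis
    unfolding edge_name_def by (intro the_equality) (use * in metis)+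
qed

text \<open>The case split reflects that \<open>u\<close> need not precede \<open>m\<close>: from
  the second edge on, sources are consecutive numbers, the first of them being
  \<open>m\<close>.\<close>

lemma chain_edge:
  "e \<in> set (chain u m z) \<Longrightarrow>
    \<exists>k<length z. e = Edge (if k = 0 then u else m + k - 1) (z ! k) (m + k)"
proof (induction z arbitrary: u m)
  case (Cons i z)
  then consider "e = Edge u i m" | "e \<in> set (chain m (Suc m) z)" by auto
  then show ?case
  proof cases
    case 2
    with Cons.IH obtain k where "k < length z"
      "e = Edge (if k = 0 then m else Suc m + k - 1) (z ! k) (Suc m + k)" by blast
    then show ?thesis by (intro exI[of _ "Suc k"]) auto
  qed auto
qed simp

lemma chain_path:
  "set (chain u m z) \<subseteq> edges D \<Longrightarrow> u \<in> vertices D \<Longrightarrow> e \<in> set (chain u m z) \<Longrightarrow>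
    (\<exists>x. path D u x (src e)) \<and> (\<exists>x. path D u x (tgt e))"
proof (induction z arbitrary: u m)
  case (Cons i z)
  have "Edge u i m \<in> edges D" using Cons.prems by simp
  then have um: "path D u [i] m" using path_edge[of "Edge u i m" D] by simp
  show ?case
  proof (cases "e = Edge u i m")
    case True
    then show ?thesis using um path.intros(1)[OF Cons.prems(2)] by auto
  next
    case False
    have "m \<in> vertices D" using \<open>Edge u i m \<in> edges D\<close> by (force simp: vertices_def)
    then have "(\<exists>x. path D m x (src e)) \<and> (\<exists>x. path D m x (tgt e))"
      using Cons.IH[of m "Suc m"] Cons.prems False by auto
    then show ?thesis using path_trans[OF um] by blast
  qed
qed simp

lemma sweep_chain:
  assumes "\<And>k. k < length z \<Longrightarrow> W (if k = 0 then u else m + k - 1) = state (y @ take k z)"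
  shows "sweep n W y (pos_word (chain u m z)) (y @ z) {#}"
    and "sweep n W (y @ z) (inv_word (chain u m z)) y {#}"
proof -
  have "sweep n W y (pos_word (chain u m z)) (y @ z) {#} \<and>
    sweep n W (y @ z) (inv_word (chain u m z)) y {#}"
    using assms
  proof (induction z arbitrary: y u m)
    case Nil
    then show ?case by (auto simp: pos_word_def inv_word_def intro: sweep.nil)
  next
    case (Cons i z)
    have y: "state y = W (src (Edge u i m))" using Cons.prems[of 0] by simp
    have "W (if k = 0 then m else Suc m + k - 1) = state ((y @ [i]) @ take k z)"
      if "k < length z" for k
      using Cons.prems[of "Suc k"] that by (cases k) auto
    then have IH: "sweep n W (y @ [i]) (pos_word (chain m (Suc m) z)) ((y @ [i]) @ z) {#}"
      "sweep n W ((y @ [i]) @ z) (inv_word (chain m (Suc m) z)) (y @ [i]) {#}"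
      using Cons.IH by blast+
    have "sweep n W (y @ [i]) [Neg (Edge u i m)] y {#}"
      using sweep.neg[where e = "Edge u i m" and W = W, OF y sweep.nil] by simp
    from sweep_append[OF IH(2) this] sweep.pos[where e = "Edge u i m" and W = W, OF y, of n _ "(y @ [i]) @ z"] IH(1)
    show ?case by (simp add: pos_word_def inv_word_def)
  qed
  then show "sweep n W y (pos_word (chain u m z)) (y @ z) {#}"
    "sweep n W (y @ z) (inv_word (chain u m z)) y {#}" by blast+
qed

lemma positive_word_nth: "positive_word n w \<Longrightarrow> k < length w \<Longrightarrow> w ! k \<in> {1..<n}"
  unfolding positive_word_def using nth_mem by blast

lemma represents_initial:
  assumes "positive_word n w" "positive_word n w'"
  shows "\<exists>W. represents n w w' (initial_diagram w w') W"
proof -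
  \<comment> \<open>Vertices up to \<open>length w\<close> lie on the path of \<open>w\<close>. The
    later ones are shifted by \<open>length w\<close> on the path of \<open>w'\<close>, whose start
    is the shared vertex 0.\<close>
  define W where "W v = (if v \<le> length w then state (take v w) else state (take (v - length w) w'))" for v
  define D where "D = initial_diagram w w'"
  define p where "p = chain 0 1 w"
  define p' where "p' = chain 0 (Suc (length w)) w'"
  have D: "source D = 0" "edges D = set p \<union> set p'" "faces D = []"
    "frontier D = inv_word p @ pos_word p'"
    by (simp_all add: D_def p_def p'_def initial_diagram_def Let_def)
  have W: "W (if k = 0 then 0 else 1 + k - 1) = state (take k w)" if "k \<le> length w" for k
    using that by (auto simp: W_def)
  have W': "W (if k = 0 then 0 else Suc (length w) + k - 1) = state (take k w')" for k
    by (auto simp: W_def)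
  have edge: "W (tgt e) = cross (W (src e)) (lab e) \<and> lab e \<in> {1..<n}" if "e \<in> edges D" for e
  proof -
    have take_Suc: "state (take (Suc k) z) = cross (state (take k z)) (z ! k)" if "k < length z"
      for k and z :: "nat list"
      using that by (simp add: take_Suc_conv_app_nth)
    consider "e \<in> set p" | "e \<in> set p'" using \<open>e \<in> edges D\<close> D(2) by blast
    then show ?thesis
    proof cases
      case 1
      then obtain k where "k < length w"
        "e = Edge (if k = 0 then 0 else 1 + k - 1) (w ! k) (1 + k)"
        using chain_edge unfolding p_def by blast
      then show ?thesis
        using W[of k] W[of "Suc k"] take_Suc[of k w] positive_word_nth[OF assms(1), of k] by auto
    next
      case 2
      then obtain k where "k < length w'"
        "e = Edge (if k = 0 then 0 else Suc (length w) + k - 1) (w' ! k) (Suc (length w) + k)"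
        using chain_edge unfolding p'_def by blast
      then show ?thesis
        using W'[of k] W'[of "Suc k"] take_Suc[of k w'] positive_word_nth[OF assms(2), of k] by auto
    qed
  qed
  have reach: "\<exists>x. path D (source D) x v" if "v \<in> vertices D" for v
  proof -
    have 0: "0 \<in> vertices D" by (simp add: vertices_def D)
    have "\<exists>x. path D 0 x (src e) \<and> (\<exists>x. path D 0 x (tgt e))" if "e \<in> edges D" for e
      using that chain_path[OF _ 0, of 1 w e] chain_path[OF _ 0, of "Suc (length w)" w' e]
      unfolding D p_def p'_def by blast
    then show ?thesis
      using \<open>v \<in> vertices D\<close> path.intros(1)[OF 0] unfolding vertices_def D(1) by blast
  qed
  have "sweep n W w (inv_word p) [] {#}"
    using sweep_chain(2)[of w W 0 1 "[]" n] W by (simp add: p_def)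
  moreover have "sweep n W [] (pos_word p') w' {#}"
    using sweep_chain(1)[of w' W 0 "Suc (length w)" "[]" n] W' by (simp add: p'_def)
  ultimately have "sweep n W w (frontier D) w' {#}"
    using sweep_append unfolding D(4) by fastforce
  then have "represents n w w' D W"
    using edge reach unfolding represents_def by (auto simp: D W_def)
  then show ?thesis unfolding D_def by blast
qed

text \<open>The common part of square and hexagon steps: \<open>E\<close> is the set of new edges, \<open>(p, q)\<close> the new
  face and \<open>zs\<close> the new part of the frontier.\<close>

lemma represents_add_face:
  assumes rep: "represents n w w' D W"
    and front: "frontier D = xs @ [Neg e, Pos f] @ ys"
    and W': "\<And>v. v \<in> vertices D \<Longrightarrow> W' v = W v"
    and D': "D' = D\<lparr>edges := edges D \<union> E, faces := faces D @ [(p, q)], frontier := xs @ zs @ ys\<rparr>"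
    and E: "\<And>g. g \<in> E \<Longrightarrow> W' (tgt g) = cross (W' (src g)) (lab g) \<and> lab g \<in> {1..<n}"
    and src_E: "src ` E \<subseteq> vertices D \<union> tgt ` E"
    and reach: "\<And>v. v \<in> tgt ` E \<Longrightarrow> \<exists>u\<in>vertices D. \<exists>x. path D' u x v"
    and incl: "underlying zs \<union> set p \<union> set q \<subseteq> edges D \<union> E"
    and face: "map (name_in W') q = rev (map (name_in W') p)" "distinct (map (name_in W') p)"
    and sweep: "\<And>a t t' b P Q R. deriv n a P (t @ [lab e]) \<Longrightarrow> state t = W (src e) \<Longrightarrow>
      deriv n t Q t' \<Longrightarrow> deriv n (t' @ [lab f]) R b \<Longrightarrow>
      sweep n W' a zs b (add_mset (name_in W' ` set p) (P + Q + R))"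
  shows "represents n w w' D' W'"
proof -
  note rep' = rep[unfolded represents_def]
  have fields: "source D' = source D" "edges D' = edges D \<union> E" "faces D' = faces D @ [(p, q)]"
    "frontier D' = xs @ zs @ ys"
    by (simp_all add: D')
  have ends: "src g \<in> vertices D" "tgt g \<in> vertices D" if "g \<in> edges D" for g
    using that by (auto simp: vertices_def)
  have src: "W' (src g) = W (src g)" "W' (tgt g) = W (tgt g)" if "g \<in> edges D" for g
    using ends[OF that] W' by blast+
  then have name: "name_in W' g = name_in W g" if "g \<in> edges D" for g
    using that by (simp add: name_in_def)
  have D_subset: "underlying (xs @ [Neg e, Pos f] @ ys) \<subseteq> edges D"
    using rep' front by simp
  have names: "map (name_in W') p = map (name_in W) p" "map (name_in W') q = map (name_in W) q"
    "name_in W' ` set p = name_in W ` set p" if "(p, q) \<in> set (faces D)" for p q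
  proof -
    have "set p \<subseteq> edges D" "set q \<subseteq> edges D" using that rep' by blast+
    then show "map (name_in W') p = map (name_in W) p" "map (name_in W') q = map (name_in W) q"
      "name_in W' ` set p = name_in W ` set p"
      using name by (auto intro!: image_cong)
  qed
  have path_D': "path D' u x v" if "path D u x v" for u x v
    using path_mono[OF that] by (simp add: fields)
  have "\<exists>x. path D' (source D') x v" if "v \<in> vertices D'" for v
  proof -
    have old: "\<exists>x. path D' (source D') x v" if "v \<in> vertices D" for v
      using that rep' path_D' unfolding fields by blast
    have "v \<in> vertices D \<or> v \<in> tgt ` E"
      using \<open>v \<in> vertices D'\<close> src_E unfolding vertices_def fields by blast
    then show ?thesis
    proof
      assume "v \<in> tgt ` E"
      then obtain u x where "u \<in> vertices D" "path D' u x v" using reach by blast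
      then show ?thesis using old path_trans[of D' _ _ u x v] by blast
    qed (rule old)
  qed
  moreover have "W' (source D) = state []"
    using W'[of "source D"] rep' by (simp add: vertices_def)
  moreover have "\<forall>g\<in>edges D'. W' (tgt g) = cross (W' (src g)) (lab g) \<and> lab g \<in> {1..<n}"
    using E src rep' unfolding fields by auto
  moreover have "\<forall>(p, q)\<in>set (faces D'). set p \<union> set q \<subseteq> edges D' \<and>
      map (name_in W') q = rev (map (name_in W') p) \<and> distinct (map (name_in W') p)"
  proof -
    have "set r \<union> set s \<subseteq> edges D' \<and> map (name_in W') s = rev (map (name_in W') r) \<and>
      distinct (map (name_in W') r)" if "(r, s) \<in> set (faces D)" for r s
      using that rep' unfolding names(1,2)[OF that] fields by blast
    then show ?thesis using face incl unfolding fields by auto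
  qed
  moreover have "underlying (frontier D') \<subseteq> edges D'"
    using D_subset incl by (auto simp: fields)
  moreover have "sweep n W' w (frontier D') w'
    (mset (map (\<lambda>(p, q). name_in W' ` set p) (faces D')))"
  proof -
    let ?M = "mset (map (\<lambda>(p, q). name_in W ` set p) (faces D))"
    have "sweep n W w (xs @ [Neg e, Pos f] @ ys) w' ?M"
      using rep' unfolding front by blast
    \<comment> \<open>Only the relations \<open>P\<close>, \<open>Q\<close>, \<open>R\<close> at the
      corner are rearranged. The sweeps of \<open>xs\<close> and \<open>ys\<close> carry over, as
      \<open>W'\<close> agrees with \<open>W\<close> on the old vertices.\<close>
    then obtain a t t' b L P Q R K where c: "sweep n W w xs a L" "deriv n a P (t @ [lab e])"
      "state t = W (src e)" "deriv n t Q t'" "state t' = W (src f)" "deriv n (t' @ [lab f]) R b"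
      "sweep n W b ys w' K" "?M = L + (P + Q + R) + K"
      by (rule sweep_cornerE)
    have "sweep n W' w xs a L"
      by (rule sweep_cong[OF c(1)]) (use D_subset src(1) in auto)
    moreover have "sweep n W' b ys w' K"
      by (rule sweep_cong[OF c(7)]) (use D_subset src(1) in auto)
    moreover have "sweep n W' a zs b (add_mset (name_in W' ` set p) (P + Q + R))"
      using c(2,3,4,6) by (rule sweep)
    ultimately have "sweep n W' w (frontier D') w'
        (L + (add_mset (name_in W' ` set p) (P + Q + R) + K))"
      unfolding fields by (intro sweep_append)
    moreover have "map (\<lambda>(p, q). name_in W' ` set p) (faces D) =
        map (\<lambda>(p, q). name_in W ` set p) (faces D)"
      by (rule map_cong[OF refl]) (clarsimp, erule names(3))
    then have "mset (map (\<lambda>(p, q). name_in W' ` set p) (faces D')) =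
        add_mset (name_in W' ` set p) ?M" by (simp add: fields del: mset_map map_eq_conv)
    ultimately show ?thesis using c(8) by (simp add: ac_simps)
  qed
  ultimately show ?thesis unfolding represents_def fields(1) by blast
qed

text \<open>The words for the sources of \<open>e\<close> and \<open>f\<close> are joined by a
  derivation, and derivations preserve states; so both edges leave from the same state.\<close>

lemma represents_corner:
  assumes "represents n w w' D W" "frontier D = xs @ [Neg e, Pos f] @ ys"
  obtains t where "W (src e) = state t" "W (src f) = state t"
    "e \<in> edges D" "f \<in> edges D"
    "W (tgt e) = cross (state t) (lab e)" "W (tgt f) = cross (state t) (lab f)"
    "lab e \<in> {1..<n}" "lab f \<in> {1..<n}"
    "{src e, src f, tgt e, tgt f} \<subseteq> vertices D"
proof -
  note rep = assms(1)[unfolded represents_def]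
  have "sweep n W w (xs @ [Neg e, Pos f] @ ys) w' (mset (map (\<lambda>(p, q). name_in W ` set p) (faces D)))"
    using rep unfolding assms(2) by blast
  then obtain t t' Q where "state t = W (src e)" "deriv n t Q t'" "state t' = W (src f)"
    by (rule sweep_cornerE)
  moreover have "e \<in> edges D" "f \<in> edges D" using rep unfolding assms(2) by auto
  ultimately show thesis
    using that[of t] rep deriv_state[of n t Q t'] by (auto simp: vertices_def)
qed

lemma distinct_trace: "distinct (trace (state x) y)"
  using distinct_name_list[of "x @ y"] by (simp add: name_list_append)

lemma represents_square:
  assumes rep: "represents n w w' D W"
    and front: "frontier D = xs @ [Neg e, Pos f] @ ys" and far: "\<bar>int (lab e) - int (lab f)\<bar> \<ge> 2"
    and fresh: "x \<notin> vertices D"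
    and e\<^sub>1: "e\<^sub>1 = Edge (tgt e) (lab f) x" and f\<^sub>1: "f\<^sub>1 = Edge (tgt f) (lab e) x"
    and D': "D' = D\<lparr>edges := edges D \<union> {e\<^sub>1, f\<^sub>1}, faces := faces D @ [([e, e\<^sub>1], [f, f\<^sub>1])],
      frontier := xs @ [Pos e\<^sub>1, Neg f\<^sub>1] @ ys\<rparr>"
  shows "\<exists>W'. represents n w w' D' W'"
proof -
  obtain t where t: "W (src e) = state t" "W (src f) = state t" "e \<in> edges D" "f \<in> edges D"
    "W (tgt e) = cross (state t) (lab e)" "W (tgt f) = cross (state t) (lab f)"
    "lab e \<in> {1..<n}" "lab f \<in> {1..<n}" "{src e, src f, tgt e, tgt f} \<subseteq> vertices D"
    using represents_corner[OF rep front] .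
  \<comment> \<open>By commutation this is also the state reached through \<open>f\<close> and
    \<open>f\<^sub>1\<close>.\<close>
  define W' where "W' = W(x := cross (cross (state t) (lab e)) (lab f))"
  have W': "W' v = W v" if "v \<in> vertices D" for v
    using that fresh by (auto simp: W'_def)
  have far': "\<bar>int (lab f) - int (lab e)\<bar> \<ge> 2" using far by simp
  note commute = far_letters[OF inj_state far] far_letters(2)[OF inj_state far']
  have W'_eqs: "W' (src e) = state t" "W' (src f) = state t"
    "W' (tgt e) = cross (state t) (lab e)" "W' (tgt f) = cross (state t) (lab f)"
    "W' x = cross (cross (state t) (lab e)) (lab f)"
    "W' x = cross (cross (state t) (lab f)) (lab e)"
    using t W' commute(1)[of t] by (auto simp: W'_def)
  have p: "map (name_in W') [e, e\<^sub>1] = trace (state t) [lab e, lab f]"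
    by (simp add: name_in_def W'_eqs e\<^sub>1)
  have q: "map (name_in W') [f, f\<^sub>1] = rev (trace (state t) [lab e, lab f])"
    by (simp add: name_in_def W'_eqs f\<^sub>1 commute(2,4))
  have edges_D': "edges D' = edges D \<union> {e\<^sub>1, f\<^sub>1}" by (simp add: D')
  have "represents n w w' D' W'"
  proof (rule represents_add_face[OF rep front W' D'])
    show "src ` {e\<^sub>1, f\<^sub>1} \<subseteq> vertices D \<union> tgt ` {e\<^sub>1, f\<^sub>1}"
      using t(9) by (simp add: e\<^sub>1 f\<^sub>1)
    show "\<exists>u\<in>vertices D. \<exists>y. path D' u y v" if "v \<in> tgt ` {e\<^sub>1, f\<^sub>1}" for v
    proof -
      have "v = x" using that by (auto simp: e\<^sub>1 f\<^sub>1)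
      moreover have "path D' (tgt e) [lab f] x"
        using path_edge[of e\<^sub>1 D'] by (simp add: edges_D' e\<^sub>1)
      ultimately show ?thesis using t(9) by blast
    qed
    show "underlying [Pos e\<^sub>1, Neg f\<^sub>1] \<union> set [e, e\<^sub>1] \<union> set [f, f\<^sub>1] \<subseteq> edges D \<union> {e\<^sub>1, f\<^sub>1}"
      using t(3,4) by auto
    show "map (name_in W') [f, f\<^sub>1] = rev (map (name_in W') [e, e\<^sub>1])"
      unfolding p q ..
    show "distinct (map (name_in W') [e, e\<^sub>1])"
      unfolding p by (rule distinct_trace)
    show "W' (tgt g) = cross (W' (src g)) (lab g) \<and> lab g \<in> {1..<n}" if "g \<in> {e\<^sub>1, f\<^sub>1}" for g
      using that t(7,8) by (auto simp: e\<^sub>1 f\<^sub>1 W'_eqs(3,4) simp flip: W'_eqs(5,6))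
  next
    fix a u u' b P Q R
    assume "deriv n a P (u @ [lab e])" and u: "state u = W (src e)"
      and "deriv n u Q u'" and R: "deriv n (u' @ [lab f]) R b"
    have u': "state u' = state t" using deriv_state[OF \<open>deriv n u Q u'\<close>] u t(1) by simp
    \<comment> \<open>The chain is \<open>a f\<close>, \<open>t e f\<close>, \<open>u' e f\<close>,
      \<open>u' f e\<close>, \<open>b e\<close>, where \<open>t\<close> is here called
      \<open>u\<close>: the old relations act under a longer suffix, and the third link is the
      relation of the new face.\<close>
    have "deriv n (a @ [lab f]) P (u @ [lab e, lab f])"
      using deriv_append[OF \<open>deriv n a P _\<close>, of "[lab f]"] by simp
    moreover have "deriv n (u @ [lab e, lab f]) Q (u' @ [lab e, lab f])"
      by (rule deriv_append) fact
    moreover have "deriv n (u' @ [lab e, lab f]) {#set (trace (state u') [lab e, lab f])#} (u' @ [lab f, lab e])"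
      by (rule deriv_single[OF named_step_commute[OF t(7,8) far]])
    moreover have "deriv n (u' @ [lab f, lab e]) R (b @ [lab e])"
      using deriv_append[OF R, of "[lab e]"] by simp
    ultimately have "deriv n (a @ [lab f]) (P + (Q + ({#set (trace (state u') [lab e, lab f])#} + R))) (b @ [lab e])"
      by (meson deriv_trans)
    then have *: "deriv n (a @ [lab f]) (add_mset (name_in W' ` set [e, e\<^sub>1]) (P + Q + R)) (b @ [lab e])"
      unfolding set_map[symmetric] p u' by (simp add: ac_simps)
    have "state a = W' (src e\<^sub>1)" "state b = W' (src f\<^sub>1)"
      using deriv_state[OF \<open>deriv n a P _\<close>] deriv_state[OF R] u u' t(1)
      by (simp_all add: e\<^sub>1 f\<^sub>1 W'_eqs)
    then show "sweep n W' a [Pos e\<^sub>1, Neg f\<^sub>1] b (add_mset (name_in W' ` set [e, e\<^sub>1]) (P + Q + R))"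
      using sweep.pos[OF _ deriv_sweep[OF _ sweep.neg[OF _ sweep.nil]], of a W' e\<^sub>1 n _ b f\<^sub>1] *
      by (simp add: e\<^sub>1 f\<^sub>1)
  qed
  then show ?thesis by blast
qed

lemma represents_hexagon:
  assumes rep: "represents n w w' D W"
    and front: "frontier D = xs @ [Neg e, Pos f] @ ys" and near: "\<bar>int (lab e) - int (lab f)\<bar> = 1"
    and fresh: "distinct [x, y, z]" "{x, y, z} \<inter> vertices D = {}"
    and e\<^sub>1: "e\<^sub>1 = Edge (tgt e) (lab f) x" and e\<^sub>2: "e\<^sub>2 = Edge x (lab e) z"
    and f\<^sub>1: "f\<^sub>1 = Edge (tgt f) (lab e) y" and f\<^sub>2: "f\<^sub>2 = Edge y (lab f) z"
    and D': "D' = D\<lparr>edges := edges D \<union> {e\<^sub>1, e\<^sub>2, f\<^sub>1, f\<^sub>2},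
      faces := faces D @ [([e, e\<^sub>1, e\<^sub>2], [f, f\<^sub>1, f\<^sub>2])],
      frontier := xs @ [Pos e\<^sub>1, Pos e\<^sub>2, Neg f\<^sub>2, Neg f\<^sub>1] @ ys\<rparr>"
  shows "\<exists>W'. represents n w w' D' W'"
proof -
  obtain t where t: "W (src e) = state t" "W (src f) = state t" "e \<in> edges D" "f \<in> edges D"
    "W (tgt e) = cross (state t) (lab e)" "W (tgt f) = cross (state t) (lab f)"
    "lab e \<in> {1..<n}" "lab f \<in> {1..<n}" "{src e, src f, tgt e, tgt f} \<subseteq> vertices D"
    using represents_corner[OF rep front] .
  \<comment> \<open>\<open>x\<close> and \<open>y\<close> lie halfway on the two new sides; at the
    sink \<open>z\<close> both triple products give the same state.\<close>
  define W' where "W' = W(x := cross (cross (state t) (lab e)) (lab f),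
    y := cross (cross (state t) (lab f)) (lab e),
    z := cross (cross (cross (state t) (lab e)) (lab f)) (lab e))"
  have W': "W' v = W v" if "v \<in> vertices D" for v
    using that fresh by (auto simp: W'_def)
  note braid = adjacent_letters[OF inj_state near]
  have W'_eqs: "W' (src e) = state t" "W' (src f) = state t"
    "W' (tgt e) = cross (state t) (lab e)" "W' (tgt f) = cross (state t) (lab f)"
    "W' x = cross (cross (state t) (lab e)) (lab f)"
    "W' y = cross (cross (state t) (lab f)) (lab e)"
    "W' z = cross (cross (cross (state t) (lab e)) (lab f)) (lab e)"
    "W' z = cross (cross (cross (state t) (lab f)) (lab e)) (lab f)"
    using t W' fresh(1) braid(1)[of t] by (auto simp: W'_def)
  have p: "map (name_in W') [e, e\<^sub>1, e\<^sub>2] = trace (state t) [lab e, lab f, lab e]"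
    by (simp add: name_in_def W'_eqs e\<^sub>1 e\<^sub>2)
  have "map (name_in W') [f, f\<^sub>1, f\<^sub>2] = trace (state t) [lab f, lab e, lab f]"
    by (simp add: name_in_def W'_eqs f\<^sub>1 f\<^sub>2)
  then have q: "map (name_in W') [f, f\<^sub>1, f\<^sub>2] = rev (trace (state t) [lab e, lab f, lab e])"
    unfolding braid(2) .
  have edges_D': "edges D' = edges D \<union> {e\<^sub>1, e\<^sub>2, f\<^sub>1, f\<^sub>2}" by (simp add: D')
  have "represents n w w' D' W'"
  proof (rule represents_add_face[OF rep front W' D'])
    show "src ` {e\<^sub>1, e\<^sub>2, f\<^sub>1, f\<^sub>2} \<subseteq> vertices D \<union> tgt ` {e\<^sub>1, e\<^sub>2, f\<^sub>1, f\<^sub>2}"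
      using t(9) by (simp add: e\<^sub>1 f\<^sub>1 e\<^sub>2 f\<^sub>2)
    show "\<exists>u\<in>vertices D. \<exists>l. path D' u l v" if "v \<in> tgt ` {e\<^sub>1, e\<^sub>2, f\<^sub>1, f\<^sub>2}" for v
    proof -
      have path: "path D' (tgt e) [lab f] x" "path D' x [lab e] z" "path D' (tgt f) [lab e] y"
        using path_edge[of e\<^sub>1 D'] path_edge[of e\<^sub>2 D'] path_edge[of f\<^sub>1 D']
        by (simp_all add: edges_D' e\<^sub>1 e\<^sub>2 f\<^sub>1)
      moreover have "v \<in> {x, y, z}" using that by (auto simp: e\<^sub>1 f\<^sub>1 e\<^sub>2 f\<^sub>2)
      ultimately show ?thesis using t(9) path_trans[OF path(1,2)] by auto
    qed
    show "underlying [Pos e\<^sub>1, Pos e\<^sub>2, Neg f\<^sub>2, Neg f\<^sub>1] \<union> set [e, e\<^sub>1, e\<^sub>2] \<union> set [f, f\<^sub>1, f\<^sub>2]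
        \<subseteq> edges D \<union> {e\<^sub>1, e\<^sub>2, f\<^sub>1, f\<^sub>2}"
      using t(3,4) by auto
    show "map (name_in W') [f, f\<^sub>1, f\<^sub>2] = rev (map (name_in W') [e, e\<^sub>1, e\<^sub>2])"
      unfolding p q ..
    show "distinct (map (name_in W') [e, e\<^sub>1, e\<^sub>2])"
      unfolding p by (rule distinct_trace)
    show "W' (tgt g) = cross (W' (src g)) (lab g) \<and> lab g \<in> {1..<n}"
      if "g \<in> {e\<^sub>1, e\<^sub>2, f\<^sub>1, f\<^sub>2}" for g
    proof -
      have "W' x = cross (W' (tgt e)) (lab f)" "W' z = cross (W' x) (lab e)"
        "W' y = cross (W' (tgt f)) (lab e)" "W' z = cross (W' y) (lab f)"
        by (simp only: W'_eqs(3-7), simp only: W'_eqs(3-7), simp only: W'_eqs(3-7),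
          simp only: W'_eqs(6,8))
      then show ?thesis using that t(7,8) e\<^sub>1 e\<^sub>2 f\<^sub>1 f\<^sub>2 by auto
    qed
  next
    fix a u u' b P Q R
    assume "deriv n a P (u @ [lab e])" and u: "state u = W (src e)"
      and "deriv n u Q u'" and R: "deriv n (u' @ [lab f]) R b"
    let ?i = "lab e" and ?j = "lab f"
    have u': "state u' = state t" using deriv_state[OF \<open>deriv n u Q u'\<close>] u t(1) by simp
    \<comment> \<open>As for a square, with two letters appended on each side; again only the third
      link is a new relation.\<close>
    have "deriv n (a @ [?j, ?i]) P (u @ [?i, ?j, ?i])"
      using deriv_append[OF \<open>deriv n a P _\<close>, of "[?j, ?i]"] by simp
    moreover have "deriv n (u @ [?i, ?j, ?i]) Q (u' @ [?i, ?j, ?i])"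
      by (rule deriv_append) fact
    moreover have "deriv n (u' @ [?i, ?j, ?i]) {#set (trace (state u') [?i, ?j, ?i])#} (u' @ [?j, ?i, ?j])"
      by (rule deriv_single[OF named_step_braid[OF t(7,8) near]])
    moreover have "deriv n (u' @ [?j, ?i, ?j]) R (b @ [?i, ?j])"
      using deriv_append[OF R, of "[?i, ?j]"] by simp
    ultimately have "deriv n (a @ [?j, ?i]) (P + (Q + ({#set (trace (state u') [?i, ?j, ?i])#} + R))) (b @ [?i, ?j])"
      by (meson deriv_trans)
    then have *: "deriv n ((a @ [lab e\<^sub>1]) @ [lab e\<^sub>2])
        (add_mset (name_in W' ` set [e, e\<^sub>1, e\<^sub>2]) (P + Q + R)) ((b @ [lab f\<^sub>1]) @ [lab f\<^sub>2])"
      unfolding set_map[symmetric] p u' by (simp add: ac_simps e\<^sub>1 e\<^sub>2 f\<^sub>1 f\<^sub>2)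
    have ab: "state a = W' (src e\<^sub>1)" "state b = W' (src f\<^sub>1)"
      using deriv_state[OF \<open>deriv n a P _\<close>] deriv_state[OF R] u u' t(1)
      by (simp_all add: e\<^sub>1 f\<^sub>1 W'_eqs)
    then have ab': "state (a @ [lab e\<^sub>1]) = W' (src e\<^sub>2)" "state (b @ [lab f\<^sub>1]) = W' (src f\<^sub>2)"
      by (simp_all add: e\<^sub>1 f\<^sub>1 e\<^sub>2 f\<^sub>2 W'_eqs)
    have "sweep n W' ((b @ [lab f\<^sub>1]) @ [lab f\<^sub>2]) [Neg f\<^sub>2, Neg f\<^sub>1] b {#}"
      by (intro sweep.neg sweep.nil ab(2) ab'(2))
    with * have "sweep n W' ((a @ [lab e\<^sub>1]) @ [lab e\<^sub>2]) [Neg f\<^sub>2, Neg f\<^sub>1] b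
        (add_mset (name_in W' ` set [e, e\<^sub>1, e\<^sub>2]) (P + Q + R) + {#})"
      by (rule deriv_sweep)
    then show "sweep n W' a [Pos e\<^sub>1, Pos e\<^sub>2, Neg f\<^sub>2, Neg f\<^sub>1] b
        (add_mset (name_in W' ` set [e, e\<^sub>1, e\<^sub>2]) (P + Q + R))"
      unfolding add_0_right by (intro sweep.pos ab(1) ab'(1))
  qed
  then show ?thesis by blast
qed

section \<open>Identification of vertices in trivial steps\<close>

lemma vertices_rename: "vertices (rename h D) = h ` vertices D"
  by (auto simp: vertices_def rename_def rename_edge_def image_image)

lemma path_rename: "path D u x v \<Longrightarrow> path (rename h D) (h u) x (h v)"
proof (induction rule: path.induct)
  case (1 u)
  then show ?case by (intro path.intros(1)) (simp add: vertices_rename)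
next
  case (2 e x v)
  then show ?case
    using path.intros(2)[of "rename_edge h e" "rename h D" x "h v"]
    by (simp add: rename_def rename_edge_def)
qed

text \<open>The map \<open>h\<close> may merge vertices. Since it preserves states, names and sweeps
  are unaffected, and paths are mapped to paths.\<close>

lemma represents_rename:
  assumes rep: "represents n w w' D W" and h: "\<And>v. W (h v) = W v"
  shows "represents n w w' (rename h D) W"
proof -
  note rep' = rep[unfolded represents_def]
  have name: "name_in W (rename_edge h e) = name_in W e" for e
    by (simp add: name_in_def rename_edge_def h)
  have fields: "source (rename h D) = h (source D)" "edges (rename h D) = rename_edge h ` edges D"
    "faces (rename h D) = map (map_prod (map (rename_edge h)) (map (rename_edge h))) (faces D)"
    "frontier (rename h D) = map (map_signed (rename_edge h)) (frontier D)"
    by (simp_all add: rename_def)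
  have "\<exists>x. path (rename h D) (h (source D)) x v" if "v \<in> vertices (rename h D)" for v
    using that rep' path_rename unfolding vertices_rename by blast
  moreover have "\<forall>e\<in>edges (rename h D). W (tgt e) = cross (W (src e)) (lab e) \<and> lab e \<in> {1..<n}"
    using rep' by (auto simp: fields rename_edge_def h)
  moreover have "\<forall>(p, q)\<in>set (faces (rename h D)). set p \<union> set q \<subseteq> edges (rename h D) \<and>
      map (name_in W) q = rev (map (name_in W) p) \<and> distinct (map (name_in W) p)"
    using rep' by (fastforce simp: fields name comp_def)
  moreover have "underlying (frontier (rename h D)) \<subseteq> edges (rename h D)"
    using rep' by (auto simp: fields)
  moreover have "sweep n W w (frontier (rename h D)) w'
      (mset (map (\<lambda>(p, q). name_in W ` set p) (faces (rename h D))))"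
  proof -
    have "map (\<lambda>(p, q). name_in W ` set p) (faces (rename h D)) =
        map (\<lambda>(p, q). name_in W ` set p) (faces D)"
      by (auto simp: fields image_image name)
    moreover have "sweep n W w (frontier (rename h D)) w'
        (mset (map (\<lambda>(p, q). name_in W ` set p) (faces D)))"
      unfolding fields(4) by (rule sweep_map) (use rep' in \<open>auto simp: rename_edge_def h\<close>)
    ultimately show ?thesis by (simp only:)
  qed
  ultimately show ?thesis
    using rep' h unfolding represents_def fields(1) by simp
qed

lemma represents_trivial:
  assumes rep: "represents n w w' D W"
    and front: "frontier D = xs @ [Neg e, Pos f] @ ys" and eq: "lab e = lab f"
  shows "represents n w w' (rename (id(tgt f := tgt e)) (D\<lparr>frontier := xs @ ys\<rparr>)) W"
proof -
  note rep' = rep[unfolded represents_def]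
  let ?M = "mset (map (\<lambda>(p, q). name_in W ` set p) (faces D))"
  have "sweep n W w (xs @ [Neg e, Pos f] @ ys) w' ?M"
    using rep' unfolding front by blast
  then obtain a t t' b L P Q R K where c: "sweep n W w xs a L" "deriv n a P (t @ [lab e])"
    "state t = W (src e)" "deriv n t Q t'" "state t' = W (src f)" "deriv n (t' @ [lab f]) R b"
    "sweep n W b ys w' K" "?M = L + (P + Q + R) + K"
    by (rule sweep_cornerE)
  \<comment> \<open>As \<open>e\<close> and \<open>f\<close> carry the same letter, \<open>Q\<close>
    extended by that letter joins \<open>P\<close> to \<open>R\<close>, and the corner can be
    bypassed without a new relation.\<close>
  have "deriv n a (P + Q + R) b"
    using deriv_trans[OF deriv_trans[OF c(2) deriv_append[OF c(4)]]] c(6) eq by simp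
  then have sweep: "sweep n W w (xs @ ys) w' ?M"
    using sweep_append[OF c(1) deriv_sweep[OF _ c(7)]] unfolding c(8) by (metis add.assoc)
  let ?D = "D\<lparr>frontier := xs @ ys\<rparr>"
  have vertices: "vertices ?D = vertices D" by (simp add: vertices_def)
  have "path ?D u x v" if "path D u x v" for u x v
    using path_mono[OF that] by simp
  then have "\<forall>v\<in>vertices D. \<exists>x. path ?D (source D) x v"
    using rep' by blast
  then have "represents n w w' ?D W"
    using rep' sweep unfolding represents_def front vertices by simp
  \<comment> \<open>The two merged targets have the same state, so \<open>W\<close> is invariant
    under the identification.\<close>
  moreover obtain s where "W (tgt e) = cross (state s) (lab e)" "W (tgt f) = cross (state s) (lab f)"
    by (rule represents_corner[OF rep front], rule that)
  ultimately show ?thesis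
    using represents_rename[of n w w' _ W "id(tgt f := tgt e)"] eq by simp
qed

lemma represents_step:
  assumes "diagram_step D D'" "represents n w w' D W"
  shows "\<exists>W'. represents n w w' D' W'"
  using assms(1)
proof cases
  case (square xs e f ys x e\<^sub>1 f\<^sub>1)
  from square(2-6,1) show ?thesis by (rule represents_square[OF assms(2)])
next
  case (hexagon xs e f ys x y z e\<^sub>1 e\<^sub>2 f\<^sub>1 f\<^sub>2)
  from hexagon(2-9,1) show ?thesis by (rule represents_hexagon[OF assms(2)])
next
  case (trivial xs e f ys)
  show ?thesis
    unfolding trivial(1) by (rule exI) (rule represents_trivial[OF assms(2) trivial(2,3)])
qed

section \<open>From complete reversing diagrams to derivations\<close>

lemma frontier_word_step:
  assumes "diagram_step D D'"
  shows "reverse_step (frontier_word D) (frontier_word D')"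
  using assms
proof cases
  case (square xs e f ys x e\<^sub>1 f\<^sub>1)
  then show ?thesis
    using reverse_step.intros(1)[of "lab e" "lab f" "map (map_signed lab) xs" "map (map_signed lab) ys"]
    by (simp add: frontier_word_def)
next
  case (hexagon xs e f ys x y z e\<^sub>1 e\<^sub>2 f\<^sub>1 f\<^sub>2)
  then show ?thesis
    using reverse_step.intros(2)[of "lab e" "lab f" "map (map_signed lab) xs" "map (map_signed lab) ys"]
    by (simp add: frontier_word_def)
next
  case (trivial xs e f ys)
  have "map_signed lab (map_signed (rename_edge h) g) = map_signed lab g" for h g
    by (cases g) (simp_all add: rename_edge_def)
  with trivial show ?thesis
    using reverse_step.intros(3)[of "map (map_signed lab) xs" "lab e" "map (map_signed lab) ys"]
    by (simp add: frontier_word_def rename_def comp_def)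
qed

lemma frontier_word_initial:
  "frontier_word (initial_diagram w w') = inv_word w @ pos_word w'"
proof -
  have "map lab (chain u m z) = z" for u m z
    by (induction z arbitrary: u m) auto
  moreover have "map (map_signed lab) (pos_word c) = pos_word (map lab c)"
    "map (map_signed lab) (inv_word c) = inv_word (map lab c)" for c
    by (simp_all add: pos_word_def inv_word_def rev_map)
  ultimately show ?thesis by (simp add: frontier_word_def initial_diagram_def Let_def)
qed

lemma reversing_diagram_represents:
  assumes "positive_word n w" "positive_word n w'"
    and "right_reverses (inv_word w @ pos_word w') (pos_word v' @ inv_word v)"
    and "reversing_diagram w w' D"
  obtains W where "represents n w w' D W" "frontier_word D = pos_word v' @ inv_word v"
proof -
  have "right_reverses (inv_word w @ pos_word w') (frontier_word D) \<and>
      (\<exists>W. represents n w w' D W)"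
    using assms(4) unfolding reversing_diagram_def
  proof (elim conjE exE)
    assume "diagram_step\<^sup>*\<^sup>* (initial_diagram w w') D"
    then show ?thesis
    proof (induction rule: rtranclp_induct)
      case base
      then show ?case using represents_initial[OF assms(1,2)] frontier_word_initial by simp
    next
      case (step D D')
      then show ?case
        using represents_step frontier_word_step by (metis rtranclp.rtrancl_into_rtrancl)
    qed
  qed
  moreover obtain u u' where "frontier_word D = pos_word u' @ inv_word u"
    using assms(4) unfolding reversing_diagram_def by blast
  ultimately show thesis
    using that right_reverses_unique[OF assms(3)] by metis
qed

text \<open>The frontier is cut where it turns from positive to inverse. The first half carries
  \<open>v'\<close> as a suffix until it is read, and the second half restores the dropped letters
  of \<open>v\<close>.\<close>

lemma represents_deriv:
  assumes "represents n w w' D W" "frontier_word D = pos_word v' @ inv_word v"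
  shows "deriv n (w @ v') (mset (map (\<lambda>(p, q). name_in W ` set p) (faces D))) (w' @ v)"
proof -
  let ?M = "mset (map (\<lambda>(p, q). name_in W ` set p) (faces D))"
  obtain xs ys where s: "frontier D = xs @ ys" "map (map_signed lab) xs = pos_word v'"
    "map (map_signed lab) ys = inv_word v"
    using assms(2) by (auto simp: frontier_word_def map_eq_append_conv)
  have "sweep n W w (xs @ ys) w' ?M"
    using assms(1) unfolding represents_def s(1) by blast
  then obtain t M\<^sub>1 M\<^sub>2 where t: "sweep n W w xs t M\<^sub>1" "sweep n W t ys w' M\<^sub>2" "?M = M\<^sub>1 + M\<^sub>2"
    by (rule sweep_appendE)
  show ?thesis
    unfolding t(3) using sweep_pos_word[OF t(1) s(2)] sweep_inv_word[OF t(2) s(3)]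
    by (rule deriv_trans)
qed


section \<open>Optimality\<close>

text \<open>The names on the second side are those of the first in reversed order, so arcs that
  start at different edges always cross.\<close>

lemma face_crossings_nonempty_iff:
  assumes "represents n w w' D W" "k < num_faces D" "N \<noteq> N'"
  shows "face_crossings D k N N' \<noteq> {} \<longleftrightarrow> {N, N'} \<subseteq> name_in W ` set (fst (faces D ! k))"
proof -
  obtain p q where pq: "faces D ! k = (p, q)" by fastforce
  then have "(p, q) \<in> set (faces D)" using assms(2) by (metis nth_mem)
  then have *: "set p \<union> set q \<subseteq> edges D" "map (name_in W) q = rev (map (name_in W) p)"
    using assms(1) unfolding represents_def by blast+
  have len: "length q = length p" using *(2) by (metis length_map length_rev)
  have name: "edge_name D (p ! i) = name_in W (p ! i)"
    "edge_name D (q ! i) = name_in W (p ! (length p - Suc i))" if "i < length p" for i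
  proof -
    have "p ! i \<in> set p" "q ! i \<in> set q" using that len by simp_all
    then have e: "p ! i \<in> edges D" "q ! i \<in> edges D" using *(1) by blast+
    have "name_in W (q ! i) = map (name_in W) q ! i" using that len by simp
    also have "\<dots> = name_in W (p ! (length p - Suc i))"
      unfolding *(2) using that by (simp add: rev_nth)
    finally show "edge_name D (p ! i) = name_in W (p ! i)"
      "edge_name D (q ! i) = name_in W (p ! (length p - Suc i))"
      using e by (simp_all add: edge_name_represents[OF assms(1)])
  qed
  show ?thesis
  proof
    assume "face_crossings D k N N' \<noteq> {}"
    then obtain i i' where "i < length p" "edge_name D (p ! i) = N"
      "i' < length p" "edge_name D (p ! i') = N'"
      by (auto simp: face_crossings_def separatrix_def pq)
    then show "{N, N'} \<subseteq> name_in W ` set (fst (faces D ! k))"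
      using name(1) by (auto simp: pq)
  next
    assume "{N, N'} \<subseteq> name_in W ` set (fst (faces D ! k))"
    then obtain i i' where i: "i < length p" "name_in W (p ! i) = N"
      "i' < length p" "name_in W (p ! i') = N'"
      by (auto simp: pq in_set_conv_nth)
    \<comment> \<open>Reversal sends position \<open>i\<close> to \<open>length p - Suc i\<close>,
      where the arc of the name ends.\<close>
    define \<alpha> where "\<alpha> = (i, length p - Suc i)"
    define \<beta> where "\<beta> = (i', length p - Suc i')"
    have "\<alpha> \<in> separatrix D N k" "\<beta> \<in> separatrix D N' k"
      using i name len by (auto simp: separatrix_def pq \<alpha>_def \<beta>_def)
    moreover have "i \<noteq> i'" using i(2,4) assms(3) by auto
    then have "arcs_cross \<alpha> \<beta>"
      using i(1,3) unfolding arcs_cross_def \<alpha>_def \<beta>_def prod.case by linarith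
    ultimately show "face_crossings D k N N' \<noteq> {}"
      unfolding face_crossings_def by blast
  qed
qed

text \<open>Needed since \<open>card\<close> is 0 on infinite sets: without finiteness a bound on
  \<open>card\<close> would not limit the crossings.\<close>

lemma finite_crossings: "finite (crossings D N N')"
proof -
  have "finite (separatrix D N k)" for N k
    by (rule finite_subset[of _ "{..<length (fst (faces D ! k))} \<times> {..<length (snd (faces D ! k))}"])
      (auto simp: separatrix_def)
  moreover have "face_crossings D k N N' \<subseteq> Pow (separatrix D N k \<union> separatrix D N' k)" for k
    by (auto simp: face_crossings_def)
  ultimately have "finite (face_crossings D k N N')" for k
    by (meson finite_Pow_iff finite_UnI finite_subset)
  then show ?thesis unfolding crossings_def by blast
qed

theorem corollary4p9:
  fixes n :: nat and w w' v v' :: "nat list" and D :: diagram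
  assumes "n \<ge> 2"
    and "positive_word n w" and "positive_word n w'"
    and "positive_word n v" and "positive_word n v'"
    and "right_reverses (inv_word w @ pos_word w') (pos_word v' @ inv_word v)"
    and "reversing_diagram w w' D"
    and "\<exists>F \<subseteq> names n. sparse F \<and> one_crossing_per_face D F \<and> cross_at_most_once D F"
  shows "comb_dist n (w @ v') (w' @ v) = num_faces D"
proof -
  obtain W where W: "represents n w w' D W" and front: "frontier_word D = pos_word v' @ inv_word v"
    using reversing_diagram_represents[OF assms(2,3,6,7)] .
  obtain F where F: "sparse F" "one_crossing_per_face D F" "cross_at_most_once D F"
    using assms(8) by blast
  define names_of where "names_of p = name_in W ` set (fst p)" for p :: "edge list \<times> edge list"
  have deriv: "deriv n (w @ v') (mset (map names_of (faces D))) (w' @ v)"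
    using represents_deriv[OF W front] unfolding names_of_def by (simp add: case_prod_beta')
  have "\<exists>N N'. N \<in> F \<and> N' \<in> F \<and> N \<noteq> N' \<and> face_crossings D k N N' \<noteq> {}"
    if "k < num_faces D" for k
  proof -
    have "card (\<Union>N\<in>F. \<Union>N'\<in>F - {N}. face_crossings D k N N') = 1"
      using F(2) that unfolding one_crossing_per_face_def by blast
    then have "(\<Union>N\<in>F. \<Union>N'\<in>F - {N}. face_crossings D k N N') \<noteq> {}"
      by (metis card.empty zero_neq_one)
    then show ?thesis by blast
  qed
  then obtain N N' where N: "N k \<in> F" "N' k \<in> F" "N k \<noteq> N' k"
      "face_crossings D k (N k) (N' k) \<noteq> {}" if "k < num_faces D" for k
    by metis
  \<comment> \<open>The pair chosen for face \<open>k\<close> already crosses there, so a crossing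
    in face \<open>l\<close> would be a second one unless \<open>l = k\<close>.\<close>
  have unique: "{N k, N' k} \<subseteq> names_of (faces D ! l) \<longleftrightarrow> l = k"
    if k: "k < num_faces D" and l: "l < num_faces D" for k l
  proof -
    have "l = k" if ne: "face_crossings D l (N k) (N' k) \<noteq> {}"
    proof -
      obtain c d where "(k, c) \<in> crossings D (N k) (N' k)" "(l, d) \<in> crossings D (N k) (N' k)"
        using N(4)[OF k] ne k l unfolding crossings_def by blast
      moreover have "card (crossings D (N k) (N' k)) \<le> Suc 0"
        using F(3) N(1-3)[OF k] unfolding cross_at_most_once_def by simp
      ultimately show "l = k"
        using card_le_Suc0_iff_eq[OF finite_crossings] by blast
    qed
    then show ?thesis
      using face_crossings_nonempty_iff[OF W l N(3)[OF k]] N(4)[OF k]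
      unfolding names_of_def by auto
  qed
  define P where "P k = {N k, N' k}" for k
  have "inj_on P {..<num_faces D}"
  proof (rule inj_onI)
    fix k l assume "k \<in> {..<num_faces D}" "l \<in> {..<num_faces D}" "P k = P l"
    then show "k = l" using unique[of k k] unique[of l k] by (simp add: P_def)
  qed
  then have card: "card (P ` {..<num_faces D}) = num_faces D"
    by (simp add: card_image)
  have flipped: "(N k, N' k) \<in> prec (name_list (w @ v')) \<longleftrightarrow>
      (N k, N' k) \<notin> prec (name_list (w' @ v))" if k: "k < num_faces D" for k
  proof -
    let ?Ss = "map names_of (faces D)"
    have "size (filter_mset (\<lambda>S. {N k, N' k} \<subseteq> S) (mset ?Ss)) =
        card {l. l < length ?Ss \<and> {N k, N' k} \<subseteq> ?Ss ! l}"
      by (metis length_filter_conv_card mset_filter size_mset)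
    \<comment> \<open>Exactly one relation of the derivation reverses both names, and 1 is
      odd.\<close>
    also have "{l. l < length ?Ss \<and> {N k, N' k} \<subseteq> ?Ss ! l} = {k}"
      using unique[OF k] k by (simp del: insert_subset cong: conj_cong)
    finally show ?thesis
      using deriv_parity[OF deriv N(3)[OF k]] by simp
  qed
  have lower: "num_faces D \<le> m" if "(braid_step n ^^ m) (w @ v') (w' @ v)" for m
  proof -
    have "card (P ` {..<num_faces D}) \<le> m"
    proof (rule sparse_lower_bound[OF F(1) that])
      fix Q assume "Q \<in> P ` {..<num_faces D}"
      then obtain k where k: "k < num_faces D" "Q = {N k, N' k}" unfolding P_def by blast
      show "\<exists>N N'. Q = {N, N'} \<and> N \<noteq> N' \<and> {N, N'} \<subseteq> F \<and>
          ((N, N') \<in> prec (name_list (w @ v')) \<longleftrightarrow> (N, N') \<notin> prec (name_list (w' @ v)))"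
        by (rule exI[of _ "N k"], rule exI[of _ "N' k"])
          (simp only: k(2) N(1-3)[OF k(1)] flipped[OF k(1)] insert_subset empty_subsetI simp_thms)
    qed
    then show ?thesis by (simp add: card)
  qed
  have "(braid_step n ^^ num_faces D) (w @ v') (w' @ v)"
    using deriv_relpowp[OF deriv] by simp
  then show ?thesis
    unfolding comb_dist_def using lower by (rule Least_equality)
qed

end
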